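(* Let $\mathcal{A}$ be a semiprime, complex, unital Banach algebra with $\mathrm{soc}(\mathcal{A})\neq\{0\}$, and let $x\in\mathcal{A}$. Then $$\rho_{BF}(x)\cap\partial\sigma(x)=\Pi(x).$$ Moreover, the following assertions are equivalent: (i) $\sigma_{BF}(x)=\emptyset$; (ii) $\partial\sigma(x)\subseteq\rho_{BF}(x)$; (iii) $x$ is algebraic.
   Context: An algebra is semiprime if $\{0\}$ is its only two-sided ideal $J$ with $J^2=\{0\}$. $\mathrm{soc}(\mathcal{A})$ is the sum of all minimal right ideals of $\mathcal{A}$ (equal to the sum of all minimal left ideals), or $\{0\}$ if there are none. An element $a$ of a ring is Drazin invertible if there are $b$ in the ring and $k\in\mathbb{N}$ with $bab=b$, $ab=ba$, $a^kba=a^k$. An element $a\in\mathcal{A}$ is B-Fredholm if its image in $\mathcal{A}/\mathrm{soc}(\mathcal{A})$ is Drazin invertible. $\sigma_{BF}(x)=\{\lambda\in\mathbb{C}:x-\lambda 1\text{ is not B-Fredholm}\}$ and $\rho_{BF}(x)=\mathbb{C}\setminus\sigma_{BF}(x)$. $\sigma(x)$ is the spectrum of $x$ and $\partial\sigma(x)$ its topological boundary in $\mathbb{C}$. $\Pi(x)$ is the set of poles of the resolvent of $x$, i.e. the isolated points of $\sigma(x)$ at which $\lambda\mapsto(\lambda 1-x)^{-1}$ has a pole. $x$ is algebraic if $P(x)=0$ for some nonzero complex polynomial $P$. *)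

theory Defs
  imports
    "HOL-Analysis.Analysis"
    "HOL-Algebra.Algebraic_Closure_Type"
    "HOL-Algebra.Ideal_Product"
    "HOL-Algebra.QuotRing"
    "HOL-Algebra.Generated_Groups"
    "HOL-Computational_Algebra.Polynomial"
begin

section \<open>Complex unital Banach algebras\<close>

text \<open>
  The norm is submultiplicative and complete, and the real structure inherited from
  \<^class>\<open>real_normed_algebra\<close> is the restriction of the complex one. The normalisation
  \<open>norm 1 = 1\<close> is not required, so that both conventions in use are covered.
\<close>

class complex_banach_algebra = real_algebra_1 + real_normed_algebra + banach +
  fixes scaleC :: "complex \<Rightarrow> 'a \<Rightarrow> 'a"  (infixr \<open>*\<^sub>C\<close> 75)
  assumes scaleC_add_right: "a *\<^sub>C (x + y) = a *\<^sub>C x + a *\<^sub>C y"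
    and scaleC_add_left: "(a + b) *\<^sub>C x = a *\<^sub>C x + b *\<^sub>C x"
    and scaleC_scaleC: "a *\<^sub>C b *\<^sub>C x = (a * b) *\<^sub>C x"
    and scaleC_one: "1 *\<^sub>C x = x"
    and scaleC_complex_of_real: "complex_of_real r *\<^sub>C x = r *\<^sub>R x"
    and mult_scaleC_left: "(a *\<^sub>C x) * y = a *\<^sub>C (x * y)"
    and mult_scaleC_right: "x * (a *\<^sub>C y) = a *\<^sub>C (x * y)"
    and norm_scaleC: "norm (a *\<^sub>C x) = cmod a * norm x"


section \<open>Semiprimeness, socle and Drazin invertibility in rings\<close>

text \<open>
  These notions are stated for rings with unit. In a unital complex algebra every one- or
  two-sided ideal of the underlying ring is a complex subspace, since
  \<open>c *\<^sub>C a = a * (c *\<^sub>C 1) = (c *\<^sub>C 1) * a\<close>; hence ring ideals and algebra ideals agree.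
\<close>

definition semiprime :: "('a, 'b) ring_scheme \<Rightarrow> bool" where
  "semiprime R \<longleftrightarrow>
     (\<forall>J. ideal J R \<and> ideal_prod R J J = {\<zero>\<^bsub>R\<^esub>} \<longrightarrow> J = {\<zero>\<^bsub>R\<^esub>})"

definition right_ideal :: "'a set \<Rightarrow> ('a, 'b) ring_scheme \<Rightarrow> bool" where
  "right_ideal M R \<longleftrightarrow>
     additive_subgroup M R \<and> (\<forall>m\<in>M. \<forall>a\<in>carrier R. m \<otimes>\<^bsub>R\<^esub> a \<in> M)"

definition minimal_right_ideal :: "'a set \<Rightarrow> ('a, 'b) ring_scheme \<Rightarrow> bool" where
  "minimal_right_ideal M R \<longleftrightarrow>
     right_ideal M R \<and> M \<noteq> {\<zero>\<^bsub>R\<^esub>} \<and>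
     (\<forall>N. right_ideal N R \<and> N \<subseteq> M \<longrightarrow> N = {\<zero>\<^bsub>R\<^esub>} \<or> N = M)"

text \<open>
  The sum of a family of right ideals is the additive subgroup generated by their union;
  for the empty family this is the zero ideal.
\<close>

definition soc :: "('a, 'b) ring_scheme \<Rightarrow> 'a set" where
  "soc R = generate (add_monoid R) (\<Union> {M. minimal_right_ideal M R})"

definition drazin_invertible :: "('a, 'b) ring_scheme \<Rightarrow> 'a \<Rightarrow> bool" where
  "drazin_invertible R a \<longleftrightarrow>
     (\<exists>b\<in>carrier R. \<exists>k::nat.
        b \<otimes>\<^bsub>R\<^esub> a \<otimes>\<^bsub>R\<^esub> b = b \<and>
        a \<otimes>\<^bsub>R\<^esub> b = b \<otimes>\<^bsub>R\<^esub> a \<and>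
        (a [^]\<^bsub>R\<^esub> k) \<otimes>\<^bsub>R\<^esub> b \<otimes>\<^bsub>R\<^esub> a = a [^]\<^bsub>R\<^esub> k)"

definition b_fredholm :: "('a, 'b) ring_scheme \<Rightarrow> 'a \<Rightarrow> bool" where
  "b_fredholm R a \<longleftrightarrow> drazin_invertible (R Quot soc R) (soc R +>\<^bsub>R\<^esub> a)"


section \<open>Spectra and poles of the resolvent\<close>

definition spectrum :: "'a::complex_banach_algebra \<Rightarrow> complex set" where
  "spectrum x = {\<mu>. x - \<mu> *\<^sub>C 1 \<notin> Units ring_of_type_algebra}"

definition bf_spectrum :: "'a::complex_banach_algebra \<Rightarrow> complex set" where
  "bf_spectrum x = {\<mu>. \<not> b_fredholm ring_of_type_algebra (x - \<mu> *\<^sub>C 1)}"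

definition bf_resolvent_set :: "'a::complex_banach_algebra \<Rightarrow> complex set" where
  "bf_resolvent_set x = - bf_spectrum x"

definition resolvent :: "'a::complex_banach_algebra \<Rightarrow> complex \<Rightarrow> 'a" where
  "resolvent x \<mu> = inv\<^bsub>ring_of_type_algebra\<^esub> (\<mu> *\<^sub>C 1 - x)"

text \<open>
  A pole of order \<open>p \<ge> 1\<close> at \<open>z\<close>: on a punctured disc, \<open>f\<close> has the Laurent expansion
  \<open>f w = (\<Sum>n\<ge>-p. (w - z)\<^sup>n a\<^sub>n)\<close> with \<open>a\<^sub>-\<^sub>p \<noteq> 0\<close>; here \<open>c n\<close> is \<open>a\<^sub>n\<^sub>-\<^sub>p\<close>. The library's \<open>is_pole\<close>
  (divergence of the norm to infinity) is not adequate for vector-valued functions: the norm of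
  the resolvent tends to infinity at every isolated point of the spectrum, including its
  essential singularities.
\<close>

definition has_pole_at :: "(complex \<Rightarrow> 'a::complex_banach_algebra) \<Rightarrow> complex \<Rightarrow> bool" where
  "has_pole_at f z \<longleftrightarrow>
     (\<exists>p::nat. \<exists>c::nat \<Rightarrow> 'a. \<exists>r>0. p \<ge> 1 \<and> c 0 \<noteq> 0 \<and>
        (\<forall>w \<in> ball z r - {z}. (\<lambda>n. ((w - z) powi (int n - int p)) *\<^sub>C c n) sums f w))"

definition resolvent_poles :: "'a::complex_banach_algebra \<Rightarrow> complex set" where
  "resolvent_poles x =
     {\<mu>. \<mu> isolated_in spectrum x \<and> has_pole_at (resolvent x) \<mu>}"

definition poly_eval :: "complex poly \<Rightarrow> 'a::complex_banach_algebra \<Rightarrow> 'a" where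
  "poly_eval P x = (\<Sum>i\<le>Polynomial.degree P. Polynomial.coeff P i *\<^sub>C x ^ i)"

definition algebraic_element :: "'a::complex_banach_algebra \<Rightarrow> bool" where
  "algebraic_element x \<longleftrightarrow> (\<exists>P. P \<noteq> 0 \<and> poly_eval P x = 0)"

end

theory Submission
  imports Defs
begin

text \<open>
  Poles of the resolvent of \<open>x\<close> are exactly the points \<open>\<mu>\<close> of the spectrum at which \<open>x - \<mu>\<close> is
  Drazin invertible, and Drazin invertibility passes to quotients. Conversely, let \<open>a = x - \<mu>\<close> be
  B-Fredholm with \<open>\<mu>\<close> on the boundary of the spectrum. Sums of finitely many minimal right ideals
  satisfy the descending chain condition and have complements of their intersections with any right
  ideal. Hence, for large \<open>k\<close>, the right ideal \<open>ker a \<inter> a\<^sup>k A\<close> lies in every \<open>a\<^sup>j A\<close>, and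
  \<open>a\<^sup>k = a\<^sup>k\<^sup>+\<^sup>1 u + r\<close> with \<open>r A \<inter> a\<^sup>k\<^sup>+\<^sup>1 A = 0\<close>. If \<open>z\<close> violated \<open>ker a\<^sup>k\<^sup>+\<^sup>1 = ker a\<^sup>k\<close>, then
  \<open>a\<^sup>k (\<Sum>n. l\<^sup>n u\<^sup>n) z\<close> would be a nonzero vector killed by \<open>a - l\<close> for all small \<open>l\<close>, although \<open>a - l\<close> is
  invertible for arbitrarily small \<open>l\<close>; a similar series gives \<open>r = 0\<close>. So ascent and descent of \<open>a\<close>
  are finite, which is Drazin invertibility.

  If the whole boundary consists of poles, then the spectrum is finite, the spectral idempotents at
  its points add up to \<open>1\<close> because the spectrum in the remaining corner is empty, and a product of
  powers of the \<open>x - \<mu>\<close> vanishes.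
\<close>



section \<open>The socle of a ring\<close>

definition rideal :: "'a::ring_1 set \<Rightarrow> bool" where
  "rideal M \<longleftrightarrow> 0 \<in> M \<and> (\<forall>x\<in>M. \<forall>y\<in>M. x + y \<in> M) \<and> (\<forall>x\<in>M. \<forall>c. x * c \<in> M)"

text \<open>Minimality is stated elementwise: every nonzero element generates the whole right ideal.
  Later arguments use this form; \<open>minimal_right_ideal_RT\<close> identifies it with minimality
  under inclusion.\<close>

definition min_rideal :: "'a::ring_1 set \<Rightarrow> bool" where
  "min_rideal M \<longleftrightarrow> rideal M \<and> M \<noteq> {0} \<and> (\<forall>v\<in>M. v \<noteq> 0 \<longrightarrow> (\<forall>w\<in>M. \<exists>c. w = v * c))"

fun rsum :: "'a::ring_1 set list \<Rightarrow> 'a set" where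
  "rsum [] = {0}"
| "rsum (R # Rs) = {x + y | x y. x \<in> R \<and> y \<in> rsum Rs}"

text \<open>Each element comes with a finite list of minimal right ideals, so that statements about
  it go by induction on the list.\<close>

definition socle :: "'a::ring_1 set" where
  "socle = {x. \<exists>Rs. (\<forall>R\<in>set Rs. min_rideal R) \<and> x \<in> rsum Rs}"

lemma rideal_0: "rideal M \<Longrightarrow> 0 \<in> M"
  and rideal_add: "rideal M \<Longrightarrow> x \<in> M \<Longrightarrow> y \<in> M \<Longrightarrow> x + y \<in> M"
  and rideal_mult: "rideal M \<Longrightarrow> x \<in> M \<Longrightarrow> x * c \<in> M"
  by (auto simp: rideal_def)

lemma rideal_uminus: "rideal M \<Longrightarrow> x \<in> M \<Longrightarrow> - x \<in> M"
  using rideal_mult[of M x "- 1"] by simp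

lemma rideal_diff: "rideal M \<Longrightarrow> x \<in> M \<Longrightarrow> y \<in> M \<Longrightarrow> x - y \<in> M"
  using rideal_add[of M x "- y"] rideal_uminus[of M y] by simp

lemma rideal_inter: "rideal M \<Longrightarrow> rideal N \<Longrightarrow> rideal (M \<inter> N)"
  by (auto simp: rideal_def)

lemma rideal_plus:
  assumes "rideal M" "rideal N"
  shows "rideal {x + y | x y. x \<in> M \<and> y \<in> N}"
  unfolding rideal_def
proof (intro conjI ballI allI)
  show "0 \<in> {x + y |x y. x \<in> M \<and> y \<in> N}"
    using assms by (auto simp: rideal_def intro!: exI[of _ 0])
next
  fix u v assume "u \<in> {x + y |x y. x \<in> M \<and> y \<in> N}" "v \<in> {x + y |x y. x \<in> M \<and> y \<in> N}"
  then obtain x y x' y' where "u = x + y" "v = x' + y'" "x \<in> M" "y \<in> N" "x' \<in> M" "y' \<in> N"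
    by blast
  then have "u + v = (x + x') + (y + y')" "x + x' \<in> M" "y + y' \<in> N"
    using assms by (auto simp: rideal_def algebra_simps)
  then show "u + v \<in> {x + y |x y. x \<in> M \<and> y \<in> N}" by blast
next
  fix u c assume "u \<in> {x + y |x y. x \<in> M \<and> y \<in> N}"
  then obtain x y where "u = x + y" "x \<in> M" "y \<in> N" by blast
  then have "u * c = x * c + y * c" "x * c \<in> M" "y * c \<in> N"
    using assms by (auto simp: rideal_def algebra_simps)
  then show "u * c \<in> {x + y |x y. x \<in> M \<and> y \<in> N}" by blast
qed

lemma rideal_principal: "rideal (range ((*) (a :: 'a::ring_1)))"
  unfolding rideal_def
proof (intro conjI ballI allI)
  show "0 \<in> range ((*) a)" using rangeI[of "(*) a" 0] by simp
next
  fix x y assume "x \<in> range ((*) a)" "y \<in> range ((*) a)"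
  then obtain u v where "x = a * u" "y = a * v" by (elim imageE) simp
  then have "x + y = a * (u + v)" by (simp add: distrib_left)
  then show "x + y \<in> range ((*) a)" by simp
next
  fix x c assume "x \<in> range ((*) a)"
  then obtain u where "x = a * u" by (elim imageE) simp
  then have "x * c = a * (u * c)" by (simp add: mult.assoc)
  then show "x * c \<in> range ((*) a)" by simp
qed

lemma min_rideal_rideal: "min_rideal R \<Longrightarrow> rideal R"
  by (simp add: min_rideal_def)

section \<open>Finite sums of minimal right ideals\<close>

lemma rideal_rsum:
  assumes "\<forall>R\<in>set Rs. min_rideal R"
  shows "rideal (rsum Rs)"
  using assms
proof (induction Rs)
  case Nil
  show ?case by (simp add: rideal_def)
next
  case (Cons R Rs)
  then show ?case by (auto simp: min_rideal_rideal intro!: rideal_plus)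
qed

text \<open>The minimal ideals are added one at a time. By minimality \<open>R\<close> either lies
  in \<open>P\<close>, the sum of \<open>M\<close> and \<open>Q\<close>, or meets it only in
  \<open>0\<close>; in the second case \<open>R\<close> is added to \<open>Q\<close>.\<close>

lemma rsum_complement:
  assumes "\<forall>R\<in>set Rs. min_rideal R" and M: "rideal M"
  shows "\<exists>Q. rideal Q \<and> Q \<inter> M = {0} \<and> rsum Rs \<subseteq> {x + y | x y. x \<in> M \<and> y \<in> Q}"
  using assms(1)
proof (induction Rs)
  case Nil
  show ?case
    using M by (intro exI[of _ "{0}"]) (auto simp: rideal_def)
next
  case (Cons R Rs)
  then obtain Q where Q: "rideal Q" "Q \<inter> M = {0}" "rsum Rs \<subseteq> {x + y | x y. x \<in> M \<and> y \<in> Q}"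
    by auto
  have R: "min_rideal R" "rideal R" using Cons.prems min_rideal_rideal by auto
  define P where "P = {x + y | x y. x \<in> M \<and> y \<in> Q}"
  have P: "rideal P" unfolding P_def using M Q(1) by (rule rideal_plus)
  show ?case
  proof (cases "R \<inter> P \<subseteq> {0}")
    case False
    then obtain v where v: "v \<in> R" "v \<in> P" "v \<noteq> 0" by blast
    have "R \<subseteq> P"
      using v R(1) P by (metis min_rideal_def rideal_mult subsetI)
    then have "rsum (R # Rs) \<subseteq> P"
      using Q(3) P by (auto simp: P_def[symmetric] intro!: rideal_add)
    then show ?thesis using Q unfolding P_def by blast
  next
    case True
    define Q' where "Q' = {x + y | x y. x \<in> Q \<and> y \<in> R}"
    have "Q' \<inter> M \<subseteq> {0}"
    proof
      fix z assume "z \<in> Q' \<inter> M"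
      then obtain x y where z: "z \<in> M" "z = x + y" "x \<in> Q" "y \<in> R"
        unfolding Q'_def by blast
      have "y = z + (- x)" using z by simp
      then have "y \<in> P" unfolding P_def using z Q(1) rideal_uminus by blast
      then have "y = 0" using True z by blast
      then show "z \<in> {0}" using z Q(2) by auto
    qed
    moreover have Q'r: "rideal Q'" unfolding Q'_def using Q(1) R(2) by (rule rideal_plus)
    moreover have "rsum (R # Rs) \<subseteq> {x + y | x y. x \<in> M \<and> y \<in> Q'}"
    proof
      fix z assume "z \<in> rsum (R # Rs)"
      then obtain x y where z: "z = x + y" "x \<in> R" "y \<in> rsum Rs" by auto
      obtain m q where mq: "y = m + q" "m \<in> M" "q \<in> Q" using z Q(3) by blast
      have "z = m + (q + x)" using z mq by (simp add: algebra_simps)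
      moreover have "q + x \<in> Q'" unfolding Q'_def using z mq by blast
      ultimately show "z \<in> {x + y | x y. x \<in> M \<and> y \<in> Q'}" using mq by blast
    qed
    ultimately show ?thesis
      using rideal_0[OF M] rideal_0[OF Q'r] by (intro exI[of _ Q']) auto
  qed
qed

text \<open>Induction on the number of summands: the intersections of the chain with the sum
  \<open>W\<close> of the tail stabilise. If no member lies in \<open>W\<close>, each contains some
  \<open>w\<close> with a nonzero component in \<open>R\<close>; this component generates
  \<open>R\<close>, so a multiple of \<open>w\<close> moves any element of the chain into
  \<open>W\<close>.\<close>

lemma rsum_dcc:
  assumes "\<forall>R\<in>set Rs. min_rideal R"
    and "\<And>n. rideal (K n)" and "\<And>n. K (Suc n) \<subseteq> K n" and "K 0 \<subseteq> rsum Rs"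
  shows "\<exists>m. \<forall>j\<ge>m. K j = K m"
  using assms
proof (induction Rs arbitrary: K)
  case Nil
  have "K n = {0}" for n
  proof -
    have "K n \<subseteq> K 0" using lift_Suc_antimono_le[of K, OF Nil.prems(3)] by blast
    then show ?thesis using Nil.prems(4) rideal_0[OF Nil.prems(2)[of n]] by auto
  qed
  then show ?case by simp
next
  case (Cons R Rs)
  define W where "W = rsum Rs"
  have W: "rideal W" unfolding W_def using Cons.prems(1) by (intro rideal_rsum) auto
  have mono: "K j \<subseteq> K i" if "i \<le> j" for i j
    using lift_Suc_antimono_le[of K, OF Cons.prems(3) that] .
  have "\<exists>m. \<forall>j\<ge>m. K j \<inter> W = K m \<inter> W"
  proof (rule Cons.IH)
    show "\<forall>R\<in>set Rs. min_rideal R" using Cons.prems(1) by auto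
    show "rideal (K n \<inter> W)" for n using Cons.prems(2) W by (rule rideal_inter)
    show "K (Suc n) \<inter> W \<subseteq> K n \<inter> W" for n using Cons.prems(3) by auto
    show "K 0 \<inter> W \<subseteq> rsum Rs" by (simp add: W_def)
  qed
  then obtain m where m: "\<And>j. j \<ge> m \<Longrightarrow> K j \<inter> W = K m \<inter> W" by blast
  show ?case
  proof (cases "\<exists>j0. K j0 \<subseteq> W")
    case True
    then obtain j0 where "K j0 \<subseteq> W" by blast
    then have "K j \<inter> W = K j" if "j \<ge> max m j0" for j
      using mono[of j0 j] that by auto
    then have "K j = K (max m j0)" if "j \<ge> max m j0" for j
      using that m[of j] m[of "max m j0"] by (metis max.bounded_iff order_refl)
    then show ?thesis by blast
  next
    case False
    have "K m \<subseteq> K j" if j: "j \<ge> m" for j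
    proof
      fix v assume v: "v \<in> K m"
      from False obtain w where w: "w \<in> K j" "w \<notin> W" by blast
      have "w \<in> rsum (R # Rs)" "v \<in> rsum (R # Rs)"
        using mono[of 0 j] mono[of 0 m] w v Cons.prems(4) by blast+
      then obtain \<rho> y \<rho>' y' where *: "w = \<rho> + y" "\<rho> \<in> R" "y \<in> W" "v = \<rho>' + y'" "\<rho>' \<in> R" "y' \<in> W"
        unfolding W_def by auto
      have "\<rho> \<noteq> 0" using * w by auto
      moreover have "min_rideal R" using Cons.prems(1) by simp
      ultimately obtain c where c: "\<rho>' = \<rho> * c" using * unfolding min_rideal_def by blast
      have "v - w * c = y' - y * c" using * c by (simp add: algebra_simps)
      then have "v - w * c \<in> W" using * W rideal_diff rideal_mult by metis
      moreover have "v - w * c \<in> K m"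
        using v w mono[OF j] Cons.prems(2) by (meson rideal_diff rideal_mult subsetD)
      ultimately have "v - w * c \<in> K j" using m[OF j] by blast
      then have "(v - w * c) + w * c \<in> K j"
        using w Cons.prems(2) rideal_add rideal_mult by blast
      then show "v \<in> K j" by simp
    qed
    then show ?thesis using mono by (metis subset_antisym)
  qed
qed

section \<open>The socle as a two-sided ideal\<close>

lemma socle_minI: "min_rideal R \<Longrightarrow> x \<in> R \<Longrightarrow> x \<in> socle"
  unfolding socle_def by (intro CollectI exI[of _ "[R]"]) auto

lemma rsum_append: "rsum (Rs @ Ss) = {x + y | x y. x \<in> rsum Rs \<and> y \<in> rsum Ss}"
proof (induction Rs)
  case (Cons R Rs)
  show ?case
  proof (intro equalityI subsetI)
    fix z assume "z \<in> rsum ((R # Rs) @ Ss)"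
    then obtain r x y where "z = r + (x + y)" "r \<in> R" "x \<in> rsum Rs" "y \<in> rsum Ss"
      using Cons by auto
    then have "z = (r + x) + y" "r + x \<in> rsum (R # Rs)" "y \<in> rsum Ss"
      by (auto simp: algebra_simps)
    then show "z \<in> {x + y | x y. x \<in> rsum (R # Rs) \<and> y \<in> rsum Ss}" by blast
  next
    fix z assume "z \<in> {x + y | x y. x \<in> rsum (R # Rs) \<and> y \<in> rsum Ss}"
    then obtain r x y where z: "z = (r + x) + y" "r \<in> R" "x \<in> rsum Rs" "y \<in> rsum Ss" by auto
    then have "x + y \<in> rsum (Rs @ Ss)" using Cons by auto
    moreover have "z = r + (x + y)" using z by (simp add: algebra_simps)
    ultimately have "\<exists>p q. z = p + q \<and> p \<in> R \<and> q \<in> rsum (Rs @ Ss)" using z(2) by blast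
    then show "z \<in> rsum ((R # Rs) @ Ss)" by simp
  qed
qed auto

lemma socle_0: "0 \<in> socle"
  unfolding socle_def by (intro CollectI exI[of _ "[]"]) auto

lemma socle_add:
  assumes "x \<in> socle" "y \<in> socle"
  shows "x + y \<in> socle"
proof -
  obtain Rs Ss where "\<forall>R\<in>set Rs. min_rideal R" "x \<in> rsum Rs" "\<forall>R\<in>set Ss. min_rideal R" "y \<in> rsum Ss"
    using assms unfolding socle_def by blast
  then show ?thesis
    unfolding socle_def by (intro CollectI exI[of _ "Rs @ Ss"]) (auto simp: rsum_append)
qed

lemma socle_mult_right: "x \<in> socle \<Longrightarrow> x * c \<in> socle"
  unfolding socle_def using rideal_rsum rideal_mult by blast

text \<open>Left multiplication is a homomorphism of right modules, so the image of a simple module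
  is zero or simple. This makes the socle a left ideal as well.\<close>

lemma min_rideal_left_mult:
  assumes R: "min_rideal R"
  shows "(*) a ` R = {0} \<or> min_rideal ((*) a ` R)"
proof -
  have r: "rideal R" using R by (rule min_rideal_rideal)
  have "rideal ((*) a ` R)"
    unfolding rideal_def
  proof (intro conjI ballI allI)
    show "0 \<in> (*) a ` R" using rideal_0[OF r] by force
    fix x y assume "x \<in> (*) a ` R" "y \<in> (*) a ` R"
    then obtain u v where "x = a * u" "y = a * v" "u \<in> R" "v \<in> R" by blast
    then have "x + y = a * (u + v)" "u + v \<in> R" using r by (auto simp: algebra_simps rideal_def)
    then show "x + y \<in> (*) a ` R" by blast
  next
    fix x c assume "x \<in> (*) a ` R"
    then obtain u where "x = a * u" "u \<in> R" by blast
    then have "x * c = a * (u * c)" "u * c \<in> R" using r by (auto simp: algebra_simps rideal_def)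
    then show "x * c \<in> (*) a ` R" by blast
  qed
  moreover have "\<exists>c. w = v * c" if vw: "v \<in> (*) a ` R" "v \<noteq> 0" "w \<in> (*) a ` R" for v w
  proof -
    obtain v' w' where *: "v = a * v'" "w = a * w'" "v' \<in> R" "w' \<in> R"
      using vw(1,3) by (elim imageE) simp
    then have "v' \<noteq> 0" using vw by auto
    then obtain c where "w' = v' * c" using R * unfolding min_rideal_def by blast
    then show ?thesis using * by (metis mult.assoc)
  qed
  ultimately show ?thesis unfolding min_rideal_def by blast
qed

lemma socle_mult_left:
  assumes "x \<in> socle"
  shows "a * x \<in> socle"
proof -
  obtain Rs where "\<forall>R\<in>set Rs. min_rideal R" "x \<in> rsum Rs" using assms unfolding socle_def by blast
  then show ?thesis
  proof (induction Rs arbitrary: x)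
    case Nil
    then show ?case by (simp add: socle_0)
  next
    case (Cons R Rs)
    then obtain u v where x: "x = u + v" "u \<in> R" "v \<in> rsum Rs" by auto
    have "a * u \<in> (*) a ` R" using x by blast
    then have "a * u \<in> socle"
      using min_rideal_left_mult[of R a] Cons.prems(1) socle_0 socle_minI by (metis list.set_intros(1) singletonD)
    moreover have "a * v \<in> socle" using Cons x by auto
    ultimately show ?case using x by (simp add: distrib_left socle_add)
  qed
qed

lemma socle_uminus: "x \<in> socle \<Longrightarrow> - x \<in> socle"
  using socle_mult_right[of x "- 1"] by simp

lemma socle_diff: "x \<in> socle \<Longrightarrow> y \<in> socle \<Longrightarrow> x - y \<in> socle"
  using socle_add[of x "- y"] socle_uminus[of y] by simp



section \<open>Comparison with the ring of a type\<close>

abbreviation RT :: "'a::ring_1 ring" where "RT \<equiv> ring_of_type_algebra"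

lemma RT_simps [simp]:
  "carrier (RT :: 'a::ring_1 ring) = UNIV"
  "\<zero>\<^bsub>(RT :: 'a ring)\<^esub> = 0" "\<one>\<^bsub>(RT :: 'a ring)\<^esub> = 1"
  "(x :: 'a) \<oplus>\<^bsub>RT\<^esub> y = x + y" "x \<otimes>\<^bsub>RT\<^esub> y = x * y"
  by (simp_all add: ring_of_type_algebra_def)

lemma ring_RT: "ring (RT :: 'a::ring_1 ring)"
proof -
  have "\<exists>y. x + y = 0" for x :: 'a
    using add.right_inverse by blast
  thus ?thesis
    unfolding ring_of_type_algebra_def using add.right_inverse
    by unfold_locales (auto simp: algebra_simps Units_def)
qed

lemma RT_a_inv [simp]: "\<ominus>\<^bsub>RT\<^esub> (x::'a::ring_1) = - x"
proof -
  interpret ring "RT :: 'a ring" by (rule ring_RT)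
  show ?thesis by (rule minus_equality) simp_all
qed

lemma RT_add_inv: "inv\<^bsub>add_monoid RT\<^esub> (x::'a::ring_1) = - x"
  using RT_a_inv[of x] by (simp add: a_inv_def)

lemma right_ideal_RT: "right_ideal M (RT :: 'a::ring_1 ring) \<longleftrightarrow> rideal M"
proof -
  interpret ring "RT :: 'a ring" by (rule ring_RT)
  show ?thesis
  proof
    assume "right_ideal M RT"
    then have *: "additive_subgroup M RT" "\<forall>m\<in>M. \<forall>a. m * a \<in> M" by (auto simp: right_ideal_def)
    interpret additive_subgroup M RT by (rule *(1))
    show "rideal M" using *(2) a_closed zero_closed by (auto simp: rideal_def)
  next
    assume M: "rideal M"
    have "additive_subgroup M RT"
      by (intro additive_subgroup.intro add.subgroupI)
        (use M rideal_uminus in \<open>auto simp: rideal_def a_inv_def[symmetric]\<close>)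
    then show "right_ideal M RT" using M by (auto simp: right_ideal_def rideal_def)
  qed
qed

lemma minimal_right_ideal_RT: "minimal_right_ideal M (RT :: 'a::ring_1 ring) \<longleftrightarrow> min_rideal M"
proof
  assume M: "minimal_right_ideal M RT"
  then have r: "rideal M" by (simp add: minimal_right_ideal_def right_ideal_RT)
  have "\<exists>c. w = v * c" if "v \<in> M" "v \<noteq> 0" "w \<in> M" for v w
  proof -
    have "range ((*) v) \<subseteq> M" using that r by (auto intro: rideal_mult)
    then have "range ((*) v) = {0} \<or> range ((*) v) = M"
      using M rideal_principal[of v] by (simp add: minimal_right_ideal_def right_ideal_RT)
    moreover have "v \<in> range ((*) v)" by (metis mult.right_neutral rangeI)
    ultimately show ?thesis using that by blast
  qed
  then show "min_rideal M"
    using M r by (auto simp: min_rideal_def minimal_right_ideal_def)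
next
  assume M: "min_rideal M"
  have "N = {0} \<or> N = M" if N: "rideal N" "N \<subseteq> M" for N
  proof (cases "N \<subseteq> {0}")
    case True
    then show ?thesis using rideal_0[OF N(1)] by blast
  next
    case False
    then obtain v where "v \<in> N" "v \<noteq> 0" by blast
    then have "M \<subseteq> N" using M N by (metis min_rideal_def rideal_mult subsetD subsetI)
    then show ?thesis using N by blast
  qed
  then show "minimal_right_ideal M RT"
    using M by (auto simp: min_rideal_def minimal_right_ideal_def right_ideal_RT)
qed

lemma soc_RT: "soc (RT :: 'a::ring_1 ring) = socle"
proof -
  define U where "U = \<Union> {M. min_rideal (M :: 'a set)}"
  have soc: "soc (RT :: 'a ring) = generate (add_monoid RT) U"
    by (simp add: soc_def U_def minimal_right_ideal_RT)
  show ?thesis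
  proof (intro equalityI subsetI)
    fix x :: 'a assume "x \<in> soc RT"
    then show "x \<in> socle" unfolding soc
    proof induction
      case one then show ?case by (simp add: socle_0)
    next
      case (incl h) then show ?case by (auto simp: U_def intro: socle_minI)
    next
      case (inv h) then show ?case
        unfolding RT_add_inv by (auto simp: U_def intro: socle_minI rideal_uminus min_rideal_rideal)
    next
      case (eng h1 h2) then show ?case by (simp add: socle_add)
    qed
  next
    fix x :: 'a assume "x \<in> socle"
    then obtain Rs where "\<forall>R\<in>set Rs. min_rideal R" "x \<in> rsum Rs" unfolding socle_def by blast
    then show "x \<in> soc RT" unfolding soc
    proof (induction Rs arbitrary: x)
      case Nil
      have "\<one>\<^bsub>add_monoid (RT :: 'a ring)\<^esub> = 0" by simp
      then show ?case using Nil generate.one[of "add_monoid RT" U] by (metis rsum.simps(1) singletonD)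
    next
      case (Cons R Rs)
      then obtain u v where x: "x = u + v" "u \<in> R" "v \<in> rsum Rs" by auto
      have "u \<in> generate (add_monoid RT) U"
        by (rule generate.incl) (use x Cons.prems(1) in \<open>auto simp: U_def\<close>)
      moreover have "v \<in> generate (add_monoid RT) U"
        by (rule Cons.IH) (use Cons.prems(1) x in simp_all)
      ultimately have "u \<otimes>\<^bsub>add_monoid RT\<^esub> v \<in> generate (add_monoid RT) U"
        by (rule generate.eng)
      moreover have "u \<otimes>\<^bsub>add_monoid RT\<^esub> v = x" using x by simp
      ultimately show ?case by metis
    qed
  qed
qed

lemma ideal_socle: "ideal socle (RT :: 'a::ring_1 ring)"
proof -
  interpret ring "RT :: 'a ring" by (rule ring_RT)
  have "subgroup socle (add_monoid (RT :: 'a ring))"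
    by (rule add.subgroupI)
      (use socle_0 in \<open>auto simp: a_inv_def[symmetric] intro: socle_uminus socle_add\<close>)
  then show ?thesis
    by (intro idealI) (auto simp: ring_RT intro: socle_mult_left socle_mult_right)
qed

text \<open>The quotient map is surjective with kernel \<open>socle\<close>, so the Drazin relations
  become three congruences modulo the socle and the quotient ring disappears from the rest of the
  proof.\<close>

lemma b_fredholm_RT:
  fixes a :: "'a::ring_1"
  shows "b_fredholm RT a \<longleftrightarrow>
    (\<exists>b k. b * a * b - b \<in> socle \<and> a * b - b * a \<in> socle \<and> a ^ k * b * a - a ^ k \<in> socle)"
proof -
  define Q where "Q = (RT :: 'a ring) Quot socle"
  define h where "h = (+>\<^bsub>RT\<^esub>) (socle :: 'a set)"
  interpret ideal socle "RT :: 'a ring" by (rule ideal_socle)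
  have hom: "ring_hom_ring RT Q h" unfolding Q_def h_def by (rule rcos_ring_hom_ring)
  interpret Q: ring Q unfolding Q_def by (rule quotient_is_ring)
  interpret h: ring_hom_ring RT Q h by (rule hom)
  have carr: "carrier Q = range h"
    unfolding Q_def h_def FactRing_def A_RCOSETS_def' by auto
  have hm: "h (x * y) = h x \<otimes>\<^bsub>Q\<^esub> h y" for x y using h.hom_mult[of x y] by simp
  have hp: "h (x ^ n) = h x [^]\<^bsub>Q\<^esub> n" for x and n :: nat
    by (induction n) (use hm h.hom_one in \<open>simp_all add: power_Suc2 del: power_Suc\<close>)
  have he: "h x = h y \<longleftrightarrow> x - y \<in> socle" for x y
    using quotient_eq_iff_same_a_r_cos[OF ideal_socle, of x y] 
    by (simp add: h_def a_minus_def)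
  have "b_fredholm RT a \<longleftrightarrow> drazin_invertible Q (h a)"
    by (simp add: b_fredholm_def soc_RT Q_def h_def)
  also have "\<dots> \<longleftrightarrow> (\<exists>b k. h (b * a * b) = h b \<and> h (a * b) = h (b * a) \<and> h (a ^ k * b * a) = h (a ^ k))"
    unfolding drazin_invertible_def carr by (auto simp: hm hp)
  finally show ?thesis by (simp add: he)
qed


section \<open>Drazin inverses\<close>

definition inverses :: "'a::ring_1 \<Rightarrow> 'a \<Rightarrow> bool" where
  "inverses a b \<longleftrightarrow> a * b = 1 \<and> b * a = 1"

definition drazin_inverse :: "'a::ring_1 \<Rightarrow> nat \<Rightarrow> 'a \<Rightarrow> bool" where
  "drazin_inverse a k b \<longleftrightarrow> b * a * b = b \<and> a * b = b * a \<and> a ^ k * b * a = a ^ k"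

lemma drazin_b_fredholm: "drazin_inverse a k b \<Longrightarrow> b_fredholm RT a"
  unfolding b_fredholm_RT drazin_inverse_def
  by (rule exI[of _ b], rule exI[of _ k]) (simp add: socle_0)

text \<open>The power \<open>c = a ^ k\<close> has a group inverse: \<open>e = c * v = w * c\<close>
  is idempotent and \<open>g = e * v\<close> inverts \<open>c\<close> in the corner of
  \<open>e\<close>. The Drazin inverse of \<open>a\<close> is then
  \<open>g * a ^ (k - 1)\<close>.\<close>

lemma drazin_of_strongly_pi_regular:
  fixes a :: "'a::ring_1"
  assumes v: "a ^ k = a ^ k * a ^ k * v" and w: "a ^ k = w * a ^ k * a ^ k" and k: "k \<ge> 1"
  shows "\<exists>b. drazin_inverse a k b"
proof -
  define c where "c = a ^ k"
  have cv: "c * c * v = c" and wc: "w * c * c = c" using v w by (auto simp: c_def)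
  have ca: "c * a = a * c" by (simp add: c_def power_commutes)
  define e where "e = c * v"
  have e': "e = w * c"
  proof -
    have "e = (w * c * c) * v" by (simp only: e_def wc)
    also have "\<dots> = w * (c * c * v)" by (simp only: mult.assoc)
    finally show ?thesis by (simp only: cv)
  qed
  have ce: "c * e = c" using cv by (simp add: e_def mult.assoc)
  have ec: "e * c = c" using wc e' by simp
  have ee: "e * e = e" using ec by (simp add: e_def mult.assoc[symmetric])
  \<comment> \<open>\<open>v\<close> and \<open>w\<close> need not commute with \<open>a\<close>.
    Evaluating \<open>e * a * e\<close> once through \<open>w\<close> and once through
    \<open>v\<close> gives \<open>e * a\<close> and \<open>a * e\<close>.\<close>
  have "e * a * e = w * (c * a) * e" by (simp only: e' mult.assoc)
  also have "\<dots> = w * a * (c * e)" by (simp only: ca mult.assoc)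
  also have "\<dots> = w * (a * c)" by (simp only: ce mult.assoc)
  also have "\<dots> = e * a" by (simp only: ca[symmetric] e' mult.assoc)
  finally have "e * a * e = e * a" .
  moreover have "e * a * e = e * (a * c) * v" by (simp only: e_def mult.assoc)
  then have "e * a * e = (e * c) * a * v" by (simp only: ca[symmetric] mult.assoc)
  then have "e * a * e = a * c * v" by (simp only: ec ca)
  then have "e * a * e = a * e" by (simp only: e_def mult.assoc)
  ultimately have ea: "e * a = a * e" by simp
  define g where "g = e * v"
  have cg: "c * g = e" using ce by (simp add: e_def g_def mult.assoc[symmetric])
  have "e * v = w * (c * v)" by (simp only: e' mult.assoc)
  then have wg: "g = w * e" by (simp only: g_def e_def[symmetric])
  have gc: "g * c = e" using ec by (simp add: wg mult.assoc e'[symmetric])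
  have eg: "e * g = g" using ee by (simp add: g_def mult.assoc[symmetric])
  have ge: "g * e = g" using ee by (simp add: wg mult.assoc)
  have "g * a = g * (e * a)" using ge by (simp add: mult.assoc[symmetric])
  also have "e * a = a * (c * g)" by (simp only: ea cg)
  also have "g * (a * (c * g)) = g * (a * c) * g" by (simp only: mult.assoc)
  also have "\<dots> = (g * c) * a * g" by (simp only: ca mult.assoc)
  also have "\<dots> = a * (e * g)" by (simp only: gc ea mult.assoc)
  finally have ga: "g * a = a * g" using eg by simp
  define b where "b = g * a ^ (k - 1)"
  have pk: "a * a ^ (k - 1) = c" "a ^ (k - 1) * a = c"
    using k by (cases k; simp add: c_def power_commutes)+
  have ab: "a * b = e" using pk gc by (simp add: b_def mult.assoc[symmetric] ga[symmetric]) (simp add: mult.assoc)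
  have ba: "b * a = e" using pk gc by (simp add: b_def mult.assoc)
  have "e * b = b" using eg by (simp add: b_def mult.assoc[symmetric])
  then show ?thesis
    unfolding drazin_inverse_def
    using ab ba ce by (intro exI[of _ b]) (simp add: c_def mult.assoc)
qed

text \<open>Iterating the descent relation gives \<open>c = c * c * v\<close> for a power
  \<open>c\<close> of \<open>a\<close>. The ascent condition allows cancelling \<open>c\<close> from
  the left, and this produces the left factor \<open>w\<close>.\<close>

lemma drazin_of_descent_ascent:
  fixes a :: "'a::ring_1"
  assumes u: "a ^ k = a ^ Suc k * u" and N: "\<And>z. a ^ Suc k * z = 0 \<Longrightarrow> a ^ k * z = 0"
  shows "\<exists>b m. drazin_inverse a m b"
proof -
  have u': "a ^ k = a ^ (k + j) * u ^ j" for j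
  proof (induction j)
    case (Suc j)
    have "a ^ k = a ^ j * a ^ k * u ^ j" using Suc by (metis add.commute power_add)
    also have "\<dots> = a ^ j * (a ^ Suc k * u) * u ^ j" using u by metis
    also have "\<dots> = a ^ (j + Suc k) * (u * u ^ j)" by (simp only: power_add mult.assoc)
    finally show ?case by (simp add: add.commute)
  qed simp
  have N': "a ^ (k + j) * z = 0 \<Longrightarrow> a ^ k * z = 0" for j z
  proof (induction j arbitrary: z)
    case (Suc j)
    have "a ^ (k + j) * (a * z) = 0"
      using Suc.prems by (simp add: power_Suc2 mult.assoc del: power_Suc)
    then have "a ^ k * (a * z) = 0" by (rule Suc.IH)
    then have "a ^ Suc k * z = 0" by (simp add: power_Suc2 mult.assoc del: power_Suc)
    then show ?case by (rule N)
  qed simp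
  \<comment> \<open>\<open>Suc k\<close> rather than \<open>k\<close>, since
    \<open>drazin_of_strongly_pi_regular\<close> asks for a positive exponent.\<close>
  define m where "m = Suc k"
  define c where "c = a ^ m"
  define v where "v = u ^ m"
  have "c = a * a ^ k" by (simp add: c_def m_def)
  also have "\<dots> = a * (a ^ (k + m) * u ^ m)" using u' by metis
  also have "\<dots> = a ^ (m + m) * u ^ m" by (simp add: m_def mult.assoc)
  finally have cv: "c * c * v = c" by (simp add: c_def v_def power_add)
  have N2: "c * z = 0" if "c * c * z = 0" for z
  proof -
    have "a ^ (m + m) * z = 0" using that by (simp add: c_def power_add)
    moreover have "m + m = k + (m + 1)" by (simp add: m_def)
    ultimately have "a ^ (k + (m + 1)) * z = 0" by metis
    then have "a ^ k * z = 0" by (rule N')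
    then show ?thesis by (simp add: c_def m_def mult.assoc)
  qed
  have "c * c * (v * c - c * v) = 0"
    using cv by (simp add: right_diff_distrib mult.assoc[symmetric]) (simp add: mult.assoc)
  then have "c * (v * c - c * v) = 0" by (rule N2)
  then have cvc: "c * v * c = c" using cv by (simp add: right_diff_distrib mult.assoc)
  \<comment> \<open>This choice gives \<open>w * c = c * v\<close> after cancelling, whence
    \<open>w * c * c = c * v * c = c\<close>.\<close>
  define w where "w = c * v * v"
  have "c * c * (v * v * c - v) = 0"
  proof -
    have "c * c * (v * v * c) = c * v * c" using cv by (metis mult.assoc)
    then show ?thesis using cv cvc by (simp add: right_diff_distrib)
  qed
  then have "c * (v * v * c - v) = 0" by (rule N2)
  then have "w * c = c * v" by (simp add: w_def right_diff_distrib mult.assoc)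
  then have "w * c * c = c" using cvc by simp
  then show ?thesis
    using drazin_of_strongly_pi_regular[of a m v w] cv by (auto simp: c_def m_def)
qed



section \<open>Neumann series\<close>

lemma scaleC_zero_left [simp]: "0 *\<^sub>C (x::'a::complex_banach_algebra) = 0"
  using scaleC_add_left[of 0 0 x] by simp

lemma scaleC_zero_right [simp]: "c *\<^sub>C (0::'a::complex_banach_algebra) = 0"
  using scaleC_add_right[of c 0 "0::'a"] by simp

lemma scaleC_minus_left: "(- c) *\<^sub>C (x::'a::complex_banach_algebra) = - (c *\<^sub>C x)"
  using scaleC_add_left[of "- c" c x] by (simp add: eq_neg_iff_add_eq_0)

lemma scaleC_minus_right: "c *\<^sub>C (- x) = - (c *\<^sub>C (x::'a::complex_banach_algebra))"
  using scaleC_add_right[of c "- x" x] by (simp add: eq_neg_iff_add_eq_0)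

lemma scaleC_diff_left: "(c - d) *\<^sub>C (x::'a::complex_banach_algebra) = c *\<^sub>C x - d *\<^sub>C x"
  using scaleC_add_left[of c "- d" x] by (simp add: scaleC_minus_left)

lemma scaleC_diff_right: "c *\<^sub>C (x - y) = c *\<^sub>C x - c *\<^sub>C (y::'a::complex_banach_algebra)"
  using scaleC_add_right[of c x "- y"] by (simp add: scaleC_minus_right)

lemmas scaleC_simps = scaleC_add_left scaleC_add_right scaleC_diff_left scaleC_diff_right
  scaleC_minus_left scaleC_minus_right scaleC_scaleC scaleC_one mult_scaleC_left mult_scaleC_right

lemma power_scaleC: "(c *\<^sub>C x) ^ n = c ^ n *\<^sub>C (x::'a::complex_banach_algebra) ^ n"
  by (induction n) (simp_all add: scaleC_simps mult.commute)

lemma bounded_bilinear_scaleC: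
  "bounded_bilinear (scaleC :: complex \<Rightarrow> 'a \<Rightarrow> 'a::complex_banach_algebra)"
proof
  fix c d :: complex and x y :: 'a and r :: real
  show "(c + d) *\<^sub>C x = c *\<^sub>C x + d *\<^sub>C x" "c *\<^sub>C (x + y) = c *\<^sub>C x + c *\<^sub>C y"
    by (simp_all add: scaleC_simps)
  show "(r *\<^sub>R c) *\<^sub>C x = r *\<^sub>R (c *\<^sub>C x)" "c *\<^sub>C (r *\<^sub>R x) = r *\<^sub>R (c *\<^sub>C x)"
    by (simp_all add: scaleC_complex_of_real[symmetric] scaleC_simps scaleR_conv_of_real mult.commute)
  show "\<exists>K. \<forall>c x. norm (c *\<^sub>C (x::'a)) \<le> norm c * norm x * K"
    by (intro exI[of _ 1]) (simp add: norm_scaleC)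
qed

lemmas bounded_linear_scaleC_right = bounded_bilinear.bounded_linear_right[OF bounded_bilinear_scaleC]
lemmas bounded_linear_scaleC_left = bounded_bilinear.bounded_linear_left[OF bounded_bilinear_scaleC]

text \<open>\<open>norm 1 = 1\<close> is not assumed; the factor \<open>norm 1\<close> covers the
  case \<open>n = 0\<close>.\<close>

lemma norm_power_le: "norm ((y::'a::complex_banach_algebra) ^ n) \<le> norm (1::'a) * norm y ^ n"
proof (induction n)
  case (Suc n)
  have "norm (y ^ Suc n) \<le> norm y * norm (y ^ n)" by (simp add: norm_mult_ineq)
  also have "\<dots> \<le> norm y * (norm (1::'a) * norm y ^ n)" using Suc by (intro mult_left_mono) auto
  finally show ?case by (simp add: mult_ac)
qed simp

lemma summable_power:
  fixes y :: "'a::complex_banach_algebra"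
  assumes "norm y < 1"
  shows "summable (\<lambda>n. y ^ n)"
  by (rule summable_comparison_test'[of "\<lambda>n. norm (1::'a) * norm y ^ n" 0])
    (use assms in \<open>auto intro: summable_mult norm_power_le summable_geometric\<close>)

definition neumann :: "'a::complex_banach_algebra \<Rightarrow> 'a" where
  "neumann y = (\<Sum>n. y ^ n)"

lemma neumann_left: "norm y < 1 \<Longrightarrow> (1 - y) * neumann y = 1"
  and neumann_right: "norm y < 1 \<Longrightarrow> neumann y * (1 - y) = 1"
proof -
  assume "norm y < 1"
  note s = summable_power[OF this]
  have shift: "(\<Sum>n. y ^ Suc n) = neumann y - 1"
    using suminf_split_head[OF s] by (simp add: neumann_def)
  have "y * neumann y = neumann y - 1"
    using suminf_mult[OF s, of y] shift by (simp add: neumann_def)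
  then show "(1 - y) * neumann y = 1" by (simp add: algebra_simps)
  have "neumann y * y = neumann y - 1"
    using suminf_mult2[OF s, of y] shift by (simp add: neumann_def power_commutes)
  then show "neumann y * (1 - y) = 1" by (simp add: algebra_simps)
qed

lemma norm_neumann_le:
  fixes y :: "'a::complex_banach_algebra"
  assumes "norm y \<le> 1/2"
  shows "norm (neumann y) \<le> 2 * norm (1::'a)"
proof -
  have s: "summable (\<lambda>n. norm (1::'a) * norm y ^ n)" 
    using assms by (intro summable_mult summable_geometric) auto
  have "norm (neumann y) \<le> (\<Sum>n. norm (1::'a) * norm y ^ n)"
    unfolding neumann_def using s by (intro norm_suminf_le norm_power_le)
  also have "\<dots> = norm (1::'a) * (1 / (1 - norm y))"
    using assms by (simp add: suminf_mult summable_geometric suminf_geometric)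
  also have "\<dots> \<le> norm (1::'a) * 2"
    using assms by (intro mult_left_mono) (auto simp: field_simps)
  finally show ?thesis by simp
qed

text \<open>Multiplication is continuous, so the series may be taken termwise. Algebraic invariance
  under \<open>u\<close> thereby passes to the Neumann series.\<close>

lemma neumann_mult_kernel:
  fixes d u z :: "'a::complex_banach_algebra"
  assumes "norm u < 1" and "\<And>n. d * u ^ n * z = 0"
  shows "d * neumann u * z = 0"
proof -
  have "(\<lambda>n. u ^ n) sums neumann u"
    using summable_power[OF assms(1)] by (simp add: neumann_def summable_sums)
  then have "(\<lambda>n. d * u ^ n * z) sums (d * neumann u * z)"
    by (intro sums_mult sums_mult2)
  then show ?thesis using assms(2) by (simp add: sums_iff)
qed



section \<open>B-Fredholm elements on the boundary of the invertible group\<close>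

text \<open>The defect lies in a finite sum of minimal right ideals, so it splits along
  \<open>M\<close> and some \<open>Q\<close> that meets \<open>M\<close> only in \<open>0\<close>.
  The part in \<open>M\<close> is absorbed into \<open>u\<close>; the part in \<open>Q\<close> is
  \<open>r\<close>.\<close>

lemma socle_descent_step:
  fixes a b :: "'a::ring_1"
  assumes "a ^ k - a ^ Suc k * b \<in> socle"
  shows "\<exists>u r. a ^ k = a ^ Suc k * u + r \<and> (\<forall>c. r * c \<in> range ((*) (a ^ Suc k)) \<longrightarrow> r * c = 0)"
proof -
  define M where "M = range ((*) (a ^ Suc k))"
  obtain Rs where Rs: "\<forall>R\<in>set Rs. min_rideal R" "a ^ k - a ^ Suc k * b \<in> rsum Rs"
    using assms unfolding socle_def by blast
  obtain Q where Q: "rideal Q" "Q \<inter> M = {0}" "rsum Rs \<subseteq> {x + y | x y. x \<in> M \<and> y \<in> Q}"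
    using rsum_complement[OF Rs(1), of M] rideal_principal unfolding M_def by blast
  from subsetD[OF Q(3) Rs(2)] obtain m r where mr: "a ^ k - a ^ Suc k * b = m + r" "m \<in> M" "r \<in> Q"
    by (elim CollectE exE conjE)
  from mr(2) obtain t where t: "m = a ^ Suc k * t" unfolding M_def by blast
  have "a ^ k = (m + r) + a ^ Suc k * b" by (rule iffD1[OF diff_eq_eq mr(1)])
  also have "\<dots> = a ^ Suc k * (b + t) + r" unfolding t by (simp add: distrib_left)
  finally have "a ^ k = a ^ Suc k * (b + t) + r" .
  moreover have "r * c = 0" if "r * c \<in> M" for c
    using that mr(3) Q rideal_mult[of Q r c] by blast
  ultimately show ?thesis unfolding M_def by blast
qed

text \<open>If \<open>y = a ^ k * z\<close> and \<open>a * y = 0\<close>, then the term with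
  \<open>b\<close> vanishes and \<open>y = s * z\<close>. So the kernel of \<open>a\<close> inside
  the range of \<open>a ^ k\<close> lies in a finite sum of minimal right ideals, where the chain
  condition applies.\<close>

lemma kernel_range_stabilises:
  fixes a b :: "'a::ring_1"
  assumes "a ^ k - b * a ^ Suc k \<in> socle"
  shows "\<exists>m\<ge>k. \<forall>j\<ge>m. \<forall>y. a * y = 0 \<and> y \<in> range ((*) (a ^ m)) \<longrightarrow> y \<in> range ((*) (a ^ j))"
proof -
  define s where "s = a ^ k - b * a ^ Suc k"
  obtain Rs where Rs: "\<forall>R\<in>set Rs. min_rideal R" "s \<in> rsum Rs"
    using assms unfolding socle_def s_def by blast
  define K where "K j = {y. a * y = 0} \<inter> range ((*) (a ^ (k + j)))" for j
  have "rideal {y. a * y = 0}" by (auto simp: rideal_def algebra_simps mult.assoc[symmetric])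
  then have "rideal (K j)" for j unfolding K_def using rideal_principal by (rule rideal_inter)
  moreover have "K (Suc j) \<subseteq> K j" for j
  proof -
    have "a ^ (k + Suc j) * z = a ^ (k + j) * (a * z)" for z
      by (simp add: power_Suc2 mult.assoc del: power_Suc)
    then show ?thesis unfolding K_def by auto
  qed
  moreover have "K 0 \<subseteq> rsum Rs"
  proof
    fix y assume "y \<in> K 0"
    then obtain z where y: "y = a ^ k * z" "a * y = 0" unfolding K_def by auto
    have "y = s * z" using y by (simp add: s_def left_diff_distrib mult.assoc)
    then show "y \<in> rsum Rs" using Rs rideal_rsum rideal_mult by blast
  qed
  ultimately obtain m where m: "\<And>j. j \<ge> m \<Longrightarrow> K j = K m" using rsum_dcc[OF Rs(1)] by metis
  have "y \<in> range ((*) (a ^ j))" if "j \<ge> k + m" "a * y = 0" "y \<in> range ((*) (a ^ (k + m)))" for j y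
  proof -
    have "y \<in> K m" using that by (simp add: K_def)
    then have "y \<in> K (j - k)" using m[of "j - k"] that(1) by simp
    then show ?thesis using that(1) by (simp add: K_def)
  qed
  then show ?thesis by (intro exI[of _ "k + m"]) auto
qed

text \<open>For \<open>z' = (\<Sum>n. l\<^sup>n u\<^sup>n) z\<close> the vector \<open>a\<^sup>k z'\<close> is an eigenvector of \<open>a\<close> for \<open>l\<close>, hence zero along a
  sequence \<open>l \<rightarrow> 0\<close>, while \<open>a\<^sup>k z'\<close> tends to \<open>a\<^sup>k z\<close>.\<close>

lemma boundary_ascent:
  fixes a u r z :: "'a::complex_banach_algebra"
  assumes dec: "a ^ k = a ^ Suc k * u + r"
    and compl: "\<And>c. r * c \<in> range ((*) (a ^ Suc k)) \<Longrightarrow> r * c = 0"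
    and stable: "\<And>j y. j \<ge> k \<Longrightarrow> a * y = 0 \<Longrightarrow> y \<in> range ((*) (a ^ k)) \<Longrightarrow> y \<in> range ((*) (a ^ j))"
    and approx: "\<And>\<epsilon>. \<epsilon> > 0 \<Longrightarrow> \<exists>l b. cmod l < \<epsilon> \<and> inverses (a - l *\<^sub>C 1) b"
    and z: "a ^ Suc k * z = 0"
  shows "a ^ k * z = 0"
proof -
  \<comment> \<open>\<open>P z\<close> puts \<open>a ^ k * z\<close> into the ranges of all powers
    of \<open>a\<close>. This forces \<open>r * z = 0\<close> and is inherited by
    \<open>u * z\<close>.\<close>
  define P where "P z \<longleftrightarrow> (\<forall>j. a ^ k * z \<in> range ((*) (a ^ j)))" for z
  have P_eq: "a ^ k * z = a ^ Suc k * (u * z)" if Pz: "P z" for z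
  proof -
    obtain t where t: "a ^ k * z = a ^ Suc k * t" using Pz unfolding P_def by blast
    have "r * z = a ^ k * z - a ^ Suc k * u * z"
      by (subst dec) (simp add: algebra_simps)
    then have "r * z = a ^ Suc k * (t - u * z)" using t by (simp only: right_diff_distrib mult.assoc)
    then have "r * z = 0" using compl by blast
    then show ?thesis by (subst dec) (simp add: distrib_right mult.assoc)
  qed
  have low: "a ^ k * z \<in> range ((*) (a ^ j))" if "j \<le> k" for j z
  proof -
    have "a ^ k * z = a ^ j * (a ^ (k - j) * z)"
      using that by (simp add: mult.assoc[symmetric] power_add[symmetric])
    then show ?thesis by blast
  qed
  have P_u: "P (u * z)" if Pz: "P z" for z
    unfolding P_def
  proof
    fix j
    show "a ^ k * (u * z) \<in> range ((*) (a ^ j))"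
    proof (cases "j \<le> k")
      case False
      obtain t where t: "a ^ k * z = a ^ Suc j * t" using Pz unfolding P_def by blast
      \<comment> \<open>\<open>a * y = 0\<close> by \<open>P_eq\<close>, and \<open>j > k\<close>
        puts \<open>y\<close> into the range of \<open>a ^ k\<close>; \<open>stable\<close> then
        moves \<open>y\<close>, and with it \<open>a ^ k * (u * z)\<close>, into the range of
        \<open>a ^ j\<close>.\<close>
      define y where "y = a ^ k * (u * z) - a ^ j * t"
      have "a * y = a ^ Suc k * (u * z) - a ^ Suc j * t"
        by (simp add: y_def right_diff_distrib mult.assoc)
      then have "a * y = 0" using P_eq[OF Pz] t by simp
      moreover have "y = a ^ k * (u * z - a ^ (j - k) * t)"
        using False by (simp add: y_def right_diff_distrib mult.assoc[symmetric] power_add[symmetric])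
      ultimately have "y \<in> range ((*) (a ^ j))" using stable[of j y] False by auto
      then obtain t' where "y = a ^ j * t'" by blast
      then have "a ^ k * (u * z) = a ^ j * (t' + t)" by (simp add: y_def algebra_simps)
      then show ?thesis by blast
    qed (rule low)
  qed
  have "P z"
    unfolding P_def
  proof
    fix j
    show "a ^ k * z \<in> range ((*) (a ^ j))"
    proof (cases "j \<le> k")
      case False
      have "a * (a ^ k * z) = 0" using z by (simp add: mult.assoc)
      then show ?thesis using False stable[of j "a ^ k * z"] by auto
    qed (rule low)
  qed
  then have Pn: "P (u ^ n * z)" for n
    by (induction n) (auto simp: mult.assoc dest: P_u)
  \<comment> \<open>By \<open>dec\<close> this is \<open>r\<close>, in the form that turns
    \<open>d * z' = 0\<close> into the identity \<open>dz\<close>.\<close>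
  define d where "d = a ^ k - a ^ Suc k * u"
  have d0: "d * (c *\<^sub>C u) ^ n * z = 0" for c n
    using P_eq[OF Pn[of n]]
    by (simp add: d_def power_scaleC scaleC_simps left_diff_distrib mult.assoc)
  \<comment> \<open>\<open>C\<close> does not depend on \<open>l\<close>: the factor
    \<open>2 * norm 1\<close> bounds the Neumann series of \<open>l * u\<close> as long as its norm
    is at most \<open>1/2\<close>.\<close>
  define C where "C = norm (a ^ k) * (norm u * (2 * norm (1::'a) * norm z))"
  have bound: "norm (a ^ k * z) \<le> \<epsilon> * C" if \<epsilon>: "\<epsilon> > 0" "\<epsilon> * norm u \<le> 1/2" for \<epsilon>
  proof -
    obtain l b where l: "cmod l < \<epsilon>" "inverses (a - l *\<^sub>C 1) b" using approx[OF \<epsilon>(1)] by blast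
    have "cmod l * norm u \<le> \<epsilon> * norm u" using l by (intro mult_right_mono) auto
    then have nl: "norm (l *\<^sub>C u) \<le> 1/2" using \<epsilon> by (simp add: norm_scaleC)
    define z' where "z' = neumann (l *\<^sub>C u) * z"
    have "(1 - l *\<^sub>C u) * z' = z"
      using neumann_left[of "l *\<^sub>C u"] nl by (simp add: z'_def mult.assoc[symmetric])
    then have z': "z' = z + l *\<^sub>C (u * z')" by (simp add: left_diff_distrib scaleC_simps algebra_simps)
    have "d * z' = 0"
      unfolding z'_def using neumann_mult_kernel[of "l *\<^sub>C u" d z] nl d0 by (simp add: mult.assoc)
    then have dz: "a ^ k * z' = a ^ Suc k * (u * z')" by (simp add: d_def left_diff_distrib mult.assoc)
    have "a ^ Suc k * z' = a ^ Suc k * z + l *\<^sub>C (a ^ Suc k * (u * z'))"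
      by (subst z') (simp only: distrib_left mult_scaleC_right)
    then have "a * (a ^ k * z') = l *\<^sub>C (a ^ k * z')" using z dz by (simp add: mult.assoc)
    then have "(a - l *\<^sub>C 1) * (a ^ k * z') = 0" by (simp add: left_diff_distrib scaleC_simps)
    then have "b * ((a - l *\<^sub>C 1) * (a ^ k * z')) = 0" by simp
    then have "a ^ k * z' = 0" using l(2) by (simp add: inverses_def mult.assoc[symmetric])
    moreover have "a ^ k * z' = a ^ k * z + l *\<^sub>C (a ^ k * (u * z'))"
      by (subst z') (simp only: distrib_left mult_scaleC_right)
    ultimately have "a ^ k * z = - (l *\<^sub>C (a ^ k * (u * z')))" by (simp add: eq_neg_iff_add_eq_0)
    then have "norm (a ^ k * z) = cmod l * norm (a ^ k * (u * z'))" by (simp add: norm_scaleC)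
    also have "\<dots> \<le> \<epsilon> * C"
    proof (rule mult_mono)
      have "norm z' \<le> norm (neumann (l *\<^sub>C u)) * norm z" unfolding z'_def by (rule norm_mult_ineq)
      also have "\<dots> \<le> 2 * norm (1::'a) * norm z"
        by (intro mult_right_mono norm_neumann_le nl) auto
      finally have "norm (u * z') \<le> norm u * (2 * norm (1::'a) * norm z)"
        using norm_mult_ineq[of u z'] by (meson mult_left_mono norm_ge_zero order_trans)
      then show "norm (a ^ k * (u * z')) \<le> C"
        using norm_mult_ineq[of "a ^ k" "u * z'"] unfolding C_def
        by (meson mult_left_mono norm_ge_zero order_trans)
    qed (use l \<epsilon> in auto)
    finally show ?thesis .
  qed
  have "norm (a ^ k * z) \<le> 0"
  proof (rule tendsto_le)
    show "((\<lambda>\<epsilon>. \<epsilon> * C) \<longlongrightarrow> 0) (at_right 0)"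
      by (rule tendsto_eq_intros refl tendsto_ident_at)+ simp
    show "((\<lambda>_. norm (a ^ k * z)) \<longlongrightarrow> norm (a ^ k * z)) (at_right (0::real))" by simp
    have "((\<lambda>\<epsilon>. \<epsilon> * norm u) \<longlongrightarrow> 0) (at_right 0)"
      by (rule tendsto_eq_intros refl tendsto_ident_at)+ simp
    then have "\<forall>\<^sub>F \<epsilon> in at_right 0. \<epsilon> * norm u < 1/2"
      by (rule order_tendstoD) simp
    then show "\<forall>\<^sub>F \<epsilon> in at_right 0. norm (a ^ k * z) \<le> \<epsilon> * C"
      using eventually_at_right_less[of "0::real"] by eventually_elim (rule bound, auto)
  qed simp
  then show ?thesis by simp
qed

text \<open>In contrast to the ascent, a single small \<open>l\<close> suffices. The element
  \<open>\<psi>\<close> solves \<open>(a - l) * \<psi> = 1 - a * u\<close>, so that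
  \<open>r = a ^ k * (a - l) * \<psi>\<close>. Expanding by \<open>dec\<close> gives
  \<open>3\<close>, whose two sides vanish by \<open>compl\<close>; \<open>ascent\<close> and the
  Neumann series of \<open>l * u\<close> then give \<open>a ^ k * \<psi> = 0\<close>, and so
  \<open>r = 0\<close>.\<close>

lemma boundary_descent:
  fixes a u r :: "'a::complex_banach_algebra"
  assumes dec: "a ^ k = a ^ Suc k * u + r"
    and compl: "\<And>c. r * c \<in> range ((*) (a ^ Suc k)) \<Longrightarrow> r * c = 0"
    and ascent: "\<And>z. a ^ Suc k * z = 0 \<Longrightarrow> a ^ k * z = 0"
    and l: "cmod l * norm u < 1" "inverses (a - l *\<^sub>C 1) b"
  shows "a ^ k = a ^ Suc k * u"
proof -
  \<comment> \<open>If \<open>a ^ k * z = 0\<close>, then \<open>r * z\<close> lies in the range of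
    \<open>a ^ Suc k\<close> and vanishes; \<open>ascent\<close> lowers the exponent in what
    remains.\<close>
  have Nu: "a ^ k * (u * z) = 0" if "a ^ k * z = 0" for z
  proof -
    have e: "a ^ Suc k * (u * z) + r * z = 0"
      using that by (subst (asm) dec) (simp add: distrib_right mult.assoc)
    then have "r * z = a ^ Suc k * (- (u * z))" by (simp add: eq_neg_iff_add_eq_0 add.commute)
    then have "r * z = 0" using compl by blast
    then show ?thesis using e ascent by simp
  qed
  define \<psi> where "\<psi> = b * (1 - a * u)"
  have r: "r = a ^ k * (1 - a * u)"
  proof -
    have "r = a ^ k - a ^ Suc k * u" using dec by (metis add_diff_cancel_left')
    then show ?thesis by (simp add: right_diff_distrib mult.assoc[symmetric] power_commutes)
  qed
  also have "\<dots> = a ^ k * ((a - l *\<^sub>C 1) * \<psi>)"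
    using l(2) by (simp add: \<psi>_def inverses_def mult.assoc[symmetric])
  also have "\<dots> = a ^ Suc k * \<psi> - l *\<^sub>C (a ^ k * \<psi>)"
    by (simp add: left_diff_distrib right_diff_distrib mult.assoc[symmetric] scaleC_simps power_commutes)
  finally have 1: "a ^ Suc k * \<psi> = r + l *\<^sub>C (a ^ k * \<psi>)" by simp
  have 2: "a ^ k * \<psi> = a ^ Suc k * (u * \<psi>) + r * \<psi>"
    by (subst dec) (simp add: distrib_right mult.assoc)
  have 3: "a ^ Suc k * (\<psi> - l *\<^sub>C (u * \<psi>)) = r * (1 + l *\<^sub>C \<psi>)"
  proof -
    have "a ^ Suc k * (\<psi> - l *\<^sub>C (u * \<psi>)) = a ^ Suc k * \<psi> - l *\<^sub>C (a ^ Suc k * (u * \<psi>))"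
      by (simp only: right_diff_distrib mult_scaleC_right)
    also have "\<dots> = r + l *\<^sub>C (r * \<psi>)"
      using 1 by (subst (asm) 2) (simp add: scaleC_add_right)
    finally show ?thesis by (simp add: distrib_left mult_scaleC_right)
  qed
  then have "r * (1 + l *\<^sub>C \<psi>) = 0" using compl by (metis rangeI)
  then have "a ^ k * (\<psi> - l *\<^sub>C (u * \<psi>)) = 0" using 3 ascent by simp
  then have base: "a ^ k * ((1 - l *\<^sub>C u) * \<psi>) = 0" by (simp add: left_diff_distrib mult_scaleC_left)
  define \<phi> where "\<phi> = (1 - l *\<^sub>C u) * \<psi>"
  have N: "a ^ k * (u ^ n * \<phi>) = 0" for n
    by (induction n) (use base Nu in \<open>auto simp: \<phi>_def mult.assoc\<close>)
  have nl: "norm (l *\<^sub>C u) < 1" using l by (simp add: norm_scaleC)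
  have "a ^ k * neumann (l *\<^sub>C u) * \<phi> = 0"
    by (rule neumann_mult_kernel[OF nl]) (use N in \<open>simp add: power_scaleC scaleC_simps mult.assoc\<close>)
  moreover have "neumann (l *\<^sub>C u) * \<phi> = \<psi>"
    using neumann_right[OF nl] by (simp add: \<phi>_def mult.assoc[symmetric])
  ultimately have "a ^ k * \<psi> = 0" by (simp add: mult.assoc)
  then have "r = 0" using 1 by (simp add: mult.assoc)
  then show ?thesis using dec by simp
qed

theorem b_fredholm_boundary_drazin:
  fixes a :: "'a::complex_banach_algebra"
  assumes bf: "b_fredholm RT a"
    and approx: "\<And>\<epsilon>. \<epsilon> > 0 \<Longrightarrow> \<exists>l b. cmod l < \<epsilon> \<and> inverses (a - l *\<^sub>C 1) b"
  shows "\<exists>b k. drazin_inverse a k b"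
proof -
  obtain b k where *: "a * b - b * a \<in> socle" "a ^ k * b * a - a ^ k \<in> socle"
    using bf unfolding b_fredholm_RT by blast
  \<comment> \<open>\<open>b\<close> commutes with \<open>a\<close> only modulo the socle. Up to
    that, the third Drazin relation yields a left version \<open>s2\<close> for the kernels and a
    right version \<open>s1\<close> for the ranges.\<close>
  have comm: "a ^ n * b - b * a ^ n \<in> socle" for n
  proof (induction n)
    case (Suc n)
    have "a ^ Suc n * b - b * a ^ Suc n = a * (a ^ n * b - b * a ^ n) + (a * b - b * a) * a ^ n"
      by (simp add: algebra_simps)
    then show ?case using Suc *(1) by (simp add: socle_add socle_mult_left socle_mult_right del: power_Suc)
  qed (simp add: socle_0)
  have s2: "a ^ k - b * a ^ Suc k \<in> socle"
  proof -
    have "a ^ k - b * a ^ Suc k = (a ^ k * b - b * a ^ k) * a - (a ^ k * b * a - a ^ k)"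
      by (simp add: algebra_simps power_commutes)
    then show ?thesis using * comm[of k] socle_diff socle_mult_right by metis
  qed
  have s1: "a ^ k - a ^ Suc k * b \<in> socle"
  proof -
    have "a ^ k - a ^ Suc k * b = - (a ^ k * b * a - a ^ k) - a ^ k * (a * b - b * a)"
      by (simp add: algebra_simps power_Suc2 del: power_Suc)
    then show ?thesis using * socle_diff socle_mult_left socle_uminus by metis
  qed
  obtain m where m: "m \<ge> k"
    "\<And>j y. j \<ge> m \<Longrightarrow> a * y = 0 \<Longrightarrow> y \<in> range ((*) (a ^ m)) \<Longrightarrow> y \<in> range ((*) (a ^ j))"
    using kernel_range_stabilises[OF s2] by blast
  \<comment> \<open>The kernel argument has fixed the exponent \<open>m\<close>, so the descent
    relation is carried from \<open>k\<close> to the same \<open>m\<close>.\<close>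
  have "a ^ m - a ^ Suc m * b = a ^ (m - k) * (a ^ k - a ^ Suc k * b)"
    using m(1) by (simp add: right_diff_distrib mult.assoc[symmetric] power_add[symmetric] del: power_Suc)
  then have "a ^ m - a ^ Suc m * b \<in> socle" using s1 by (simp add: socle_mult_left del: power_Suc)
  then obtain u r where ur: "a ^ m = a ^ Suc m * u + r"
    "\<And>c. r * c \<in> range ((*) (a ^ Suc m)) \<Longrightarrow> r * c = 0"
    using socle_descent_step by blast
  have asc: "a ^ Suc m * z = 0 \<Longrightarrow> a ^ m * z = 0" for z
    using boundary_ascent[OF ur m(2) approx] by blast
  \<comment> \<open>Adding \<open>1\<close> keeps the bound positive when
    \<open>u = 0\<close>.\<close>
  have "1 / (norm u + 1) > 0" by (simp add: add_nonneg_pos)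
  from approx[OF this] obtain l c where l: "cmod l < 1 / (norm u + 1)" "inverses (a - l *\<^sub>C 1) c"
    by blast
  have "norm u + 1 > 0" by (simp add: add_nonneg_pos)
  then have "cmod l * (norm u + 1) < 1" using l(1) by (simp add: pos_less_divide_eq)
  moreover have "cmod l * norm u \<le> cmod l * (norm u + 1)" by (intro mult_left_mono) auto
  ultimately have "cmod l * norm u < 1" by linarith
  then have "a ^ m = a ^ Suc m * u" using boundary_descent[OF ur asc _ l(2)] by blast
  then show ?thesis using drazin_of_descent_ascent asc by blast
qed


section \<open>The spectrum is not empty\<close>

text \<open>Liouville's theorem is proved through circular means, since it is needed for functions with
  values in a Banach space and no Hahn--Banach theorem is at hand to reduce it to the scalar case.\<close>

lemma circle_mean_constant:
  fixes g g' :: "complex \<Rightarrow> 'a::complex_banach_algebra"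
  assumes g: "\<And>z. (g has_derivative (\<lambda>t. t *\<^sub>C g' z)) (at z)"
    and g': "continuous_on UNIV g'"
  shows "integral {0..2*pi} (\<lambda>t. g (of_real r * cis t)) = (2*pi) *\<^sub>R g 0"
proof -
  define F where "F r = integral (cbox 0 (2*pi)) (\<lambda>t. g (of_real r * cis t))" for r
  have cg: "continuous_on UNIV g"
    by (rule has_derivative_continuous_on) (use g in simp)
  have ccis: "continuous_on S cis" for S by (intro continuous_on_cis continuous_on_id)
  have dcis: "(cis has_vector_derivative (\<i> * cis t)) (at t within S)" for t S
    using has_derivative_cis[OF has_derivative_ident]
    by (simp add: has_vector_derivative_def scaleR_conv_of_real mult_ac)
  \<comment> \<open>Differentiation under the integral sign with respect to the radius.\<close>
  have F': "(F has_vector_derivative integral (cbox 0 (2*pi)) (\<lambda>t. cis t *\<^sub>C g' (of_real r * cis t)))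
      (at r within UNIV)" for r
    unfolding F_def
  proof (rule leibniz_rule_vector_derivative[where fx = "\<lambda>r t. cis t *\<^sub>C g' (of_real r * cis t)"])
    fix s t :: real
    have "((\<lambda>s. of_real s * cis t) has_derivative (\<lambda>h. of_real h * cis t)) (at s within UNIV)"
      by (auto intro!: derivative_eq_intros)
    from has_derivative_compose[OF this g]
    show "((\<lambda>s. g (of_real s * cis t)) has_vector_derivative cis t *\<^sub>C g' (of_real s * cis t)) (at s within UNIV)"
      by (simp add: has_vector_derivative_def scaleC_scaleC[symmetric] scaleC_complex_of_real)
    show "(\<lambda>t. g (of_real s * cis t)) integrable_on cbox 0 (2*pi)"
      by (intro integrable_continuous continuous_on_compose2[OF cg] continuous_intros) auto
  next
    have "continuous_on (UNIV \<times> cbox 0 (2*pi)) (\<lambda>p. cis (snd p) *\<^sub>C g' (of_real (fst p) * cis (snd p)))"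
      by (intro bounded_bilinear.continuous_on[OF bounded_bilinear_scaleC]
          continuous_on_compose2[OF g'] continuous_on_compose2[OF ccis[of UNIV]] continuous_intros) auto
    then show "continuous_on (UNIV \<times> cbox 0 (2*pi)) (\<lambda>(r, t). cis t *\<^sub>C g' (of_real r * cis t))"
      by (simp add: case_prod_beta')
  qed auto
  \<comment> \<open>For \<open>r \<noteq> 0\<close> the integrand is the \<open>t\<close>-derivative
    of \<open>g (r * cis t)\<close> divided by \<open>\<i> * r\<close>, whose values at both ends
    agree. For \<open>r = 0\<close> it is \<open>cis\<close> times a constant vector.\<close>
  have zero: "integral (cbox 0 (2*pi)) (\<lambda>t. cis t *\<^sub>C g' (of_real r * cis t)) = 0" for r
  proof (cases "r = 0")
    case True
    have "((\<lambda>t. cis t *\<^sub>C g' 0) has_integral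
        (- \<i> * cis (2*pi)) *\<^sub>C g' 0 - (- \<i> * cis 0) *\<^sub>C g' 0) {0..2*pi}"
    proof (rule fundamental_theorem_of_calculus)
      fix t :: real
      have "((\<lambda>t. - \<i> * cis t) has_vector_derivative - \<i> * (\<i> * cis t)) (at t within {0..2*pi})"
        by (intro has_vector_derivative_mult_right dcis)
      from bounded_linear.has_vector_derivative[OF bounded_linear_scaleC_left this]
      show "((\<lambda>t. (- \<i> * cis t) *\<^sub>C g' 0) has_vector_derivative cis t *\<^sub>C g' 0) (at t within {0..2*pi})"
        by (simp add: mult.assoc[symmetric])
    qed simp
    then show ?thesis using True by (simp add: integral_unique)
  next
    case False
    have "((\<lambda>t. cis t *\<^sub>C g' (of_real r * cis t)) has_integral
        (1 / (\<i> * of_real r)) *\<^sub>C g (of_real r * cis (2*pi)) - (1 / (\<i> * of_real r)) *\<^sub>C g (of_real r * cis 0))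
        {0..2*pi}"
    proof (rule fundamental_theorem_of_calculus)
      fix t :: real
      have "((\<lambda>t. of_real r * cis t) has_derivative (\<lambda>h. h *\<^sub>R (of_real r * (\<i> * cis t)))) (at t within {0..2*pi})"
        using has_vector_derivative_mult_right[OF dcis, of "of_real r"]
        by (simp add: has_vector_derivative_def)
      from has_derivative_compose[OF this g]
      have "((\<lambda>t. g (of_real r * cis t)) has_vector_derivative
          (of_real r * (\<i> * cis t)) *\<^sub>C g' (of_real r * cis t)) (at t within {0..2*pi})"
        by (simp add: has_vector_derivative_def scaleR_conv_of_real scaleC_scaleC[symmetric]
            scaleC_complex_of_real)
      from bounded_linear.has_vector_derivative[OF bounded_linear_scaleC_right this, of "1 / (\<i> * of_real r)"]
      show "((\<lambda>t. (1 / (\<i> * of_real r)) *\<^sub>C g (of_real r * cis t)) has_vector_derivative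
          cis t *\<^sub>C g' (of_real r * cis t)) (at t within {0..2*pi})"
        using False by (simp add: scaleC_scaleC)
    qed simp
    then show ?thesis by (simp add: integral_unique)
  qed
  have "(F has_derivative (\<lambda>h. 0)) (at r within UNIV)" for r
    using F'[of r, unfolded zero] by (simp add: has_vector_derivative_def)
  then obtain c where "\<forall>r\<in>UNIV. F r = c"
    using has_derivative_zero_constant[of UNIV F] by auto
  then have "F r = F 0" by simp
  then show ?thesis by (simp add: F_def)
qed

text \<open>\<open>g 0\<close> is the mean of \<open>g\<close> over every circle about
  \<open>0\<close>, and on large circles \<open>g\<close> is uniformly small.\<close>

lemma liouville_vanishing:
  fixes g g' :: "complex \<Rightarrow> 'a::complex_banach_algebra"
  assumes g: "\<And>z. (g has_derivative (\<lambda>t. t *\<^sub>C g' z)) (at z)"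
    and g': "continuous_on UNIV g'"
    and lim: "(g \<longlongrightarrow> 0) at_infinity"
  shows "g 0 = 0"
proof -
  have "norm (g 0) \<le> e" if e: "e > 0" for e
  proof -
    obtain R where R: "\<And>z. norm z \<ge> R \<Longrightarrow> norm (g z) < e"
      using tendstoD[OF lim e] by (auto simp: eventually_at_infinity)
    define r where "r = max R 0"
    have cg: "continuous_on UNIV g"
      by (rule has_derivative_continuous_on) (use g in simp)
    have "norm (integral {0..2*pi} (\<lambda>t. g (of_real r * cis t))) \<le> e * (2*pi - 0)"
    proof (rule integral_bound)
      show "continuous_on {0..2*pi} (\<lambda>t. g (of_real r * cis t))"
        by (intro continuous_on_compose2[OF cg] continuous_intros) auto
      have "norm (g (of_real r * cis t)) < e" for t
        by (rule R) (simp add: norm_mult r_def)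
      then show "norm (g (of_real r * cis t)) \<le> e" for t
        by (rule less_imp_le)
    qed simp
    then have "norm ((2*pi) *\<^sub>R g 0) \<le> e * (2*pi)"
      using circle_mean_constant[OF g g', of r] by simp
    then show ?thesis by simp
  qed
  then have "norm (g 0) \<le> 0" by (rule field_le_epsilon[of _ 0, simplified])
  then show ?thesis by simp
qed

text \<open>For an idempotent \<open>f\<close> commuting with \<open>x\<close>, \<open>corner_inverse f x y\<close> says that \<open>y\<close> is an inverse
  of \<open>x * f\<close> in the corner algebra \<open>f A f\<close>.\<close>

definition corner_inverse :: "'a::ring_1 \<Rightarrow> 'a \<Rightarrow> 'a \<Rightarrow> bool" where
  "corner_inverse f x y \<longleftrightarrow> y * x = f \<and> x * y = f \<and> f * y = y \<and> y * f = y"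

text \<open>Gelfand's argument in the corner: the resolvent \<open>R\<close> is entire with
  derivative its square and tends to \<open>0\<close> at infinity, so \<open>R 0 = 0\<close> by
  Liouville and \<open>f = R 0 * x = 0\<close>.\<close>

lemma corner_spectrum_nonempty:
  fixes f x :: "'a::complex_banach_algebra"
  assumes "\<And>\<mu>. \<exists>y. corner_inverse f (x - \<mu> *\<^sub>C 1) y"
  shows "f = 0"
proof -
  obtain R where "\<And>\<mu>. corner_inverse f (x - \<mu> *\<^sub>C 1) (R \<mu>)" using assms by metis
  then have R: "R \<mu> * (x - \<mu> *\<^sub>C 1) = f" "(x - \<mu> *\<^sub>C 1) * R \<mu> = f" "f * R \<mu> = R \<mu>" "R \<mu> * f = R \<mu>" for \<mu>
    by (auto simp: corner_inverse_def)
  have res: "R z - R w = (z - w) *\<^sub>C (R z * R w)" for z w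
  proof -
    have "R z * ((x - w *\<^sub>C 1) - (x - z *\<^sub>C 1)) * R w = R z * ((x - w *\<^sub>C 1) * R w) - (R z * (x - z *\<^sub>C 1)) * R w"
      by (simp only: right_diff_distrib left_diff_distrib mult.assoc)
    then have "R z * ((x - w *\<^sub>C 1) - (x - z *\<^sub>C 1)) * R w = R z - R w" by (simp only: R)
    moreover have "(x - w *\<^sub>C 1) - (x - z *\<^sub>C 1) = (z - w) *\<^sub>C (1::'a)" by (simp add: scaleC_diff_left)
    ultimately show ?thesis by (simp add: mult_scaleC_left mult_scaleC_right)
  qed
  have lim: "(R \<longlongrightarrow> R w) (at w)" for w
  proof -
    define K where "K = norm (R w)"
    \<comment> \<open>The first estimate still contains \<open>norm (R z)\<close>. For
      \<open>z\<close> close to \<open>w\<close> half of it can be absorbed, which gives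
      \<open>norm (R z) \<le> 2 * K\<close>.\<close>
    have est: "norm (R z - R w) \<le> 2 * K * K * dist z w" if z: "dist z w * K < 1/2" for z
    proof -
      have n: "norm (R z - R w) \<le> dist z w * (norm (R z) * K)"
        using norm_mult_ineq[of "R z" "R w"] 
        by (simp add: res norm_scaleC dist_norm K_def mult_left_mono)
      have "norm (R z) \<le> K + norm (R z - R w)" using norm_triangle_sub[of "R z" "R w"] by (simp add: K_def)
      also have "\<dots> \<le> K + norm (R z) * (dist z w * K)" using n by (simp add: mult_ac)
      also have "\<dots> \<le> K + norm (R z) * (1/2)" using z by (intro add_left_mono mult_left_mono) auto
      finally have "norm (R z) \<le> 2 * K" by simp
      then have "norm (R z) * K \<le> 2 * K * K" by (intro mult_right_mono) (auto simp: K_def)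
      then have "dist z w * (norm (R z) * K) \<le> dist z w * (2 * K * K)" by (intro mult_left_mono) auto
      then show ?thesis using n by (simp add: mult_ac)
    qed
    have "((\<lambda>z. dist z w * K) \<longlongrightarrow> 0) (at w)"
      by (rule tendsto_eq_intros refl tendsto_ident_at)+ simp
    then have "\<forall>\<^sub>F z in at w. dist z w * K < 1/2" by (rule order_tendstoD) simp
    then have ev: "\<forall>\<^sub>F z in at w. norm (R z - R w) \<le> 2 * K * K * dist z w"
      by eventually_elim (rule est)
    have "((\<lambda>z. 2 * K * K * dist z w) \<longlongrightarrow> 0) (at w)"
      by (rule tendsto_eq_intros refl tendsto_ident_at)+ simp
    then have "((\<lambda>z. R z - R w) \<longlongrightarrow> 0) (at w)" by (rule Lim_null_comparison[OF ev])
    then show ?thesis by (simp add: LIM_zero_iff)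
  qed
  have cont: "continuous_on UNIV R" using lim by (simp add: continuous_on_def)
  have "(R has_derivative (\<lambda>t. t *\<^sub>C (R w * R w))) (at w)" for w
  proof (rule has_derivativeI_sandwich[where e = 1 and H = "\<lambda>z. norm (R z - R w) * norm (R w)"])
    show "bounded_linear (\<lambda>t. t *\<^sub>C (R w * R w))" by (rule bounded_linear_scaleC_left)
    show "((\<lambda>z. norm (R z - R w) * norm (R w)) \<longlongrightarrow> 0) (at w)"
      by (rule tendsto_eq_intros refl lim)+ simp
    fix z assume "z \<noteq> w"
    have "R z - R w - (z - w) *\<^sub>C (R w * R w) = (z - w) *\<^sub>C (R z * R w) - (z - w) *\<^sub>C (R w * R w)"
      by (simp only: res)
    also have "\<dots> = (z - w) *\<^sub>C ((R z - R w) * R w)"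
      by (simp only: scaleC_diff_right left_diff_distrib)
    finally have "R z - R w - (z - w) *\<^sub>C (R w * R w) = (z - w) *\<^sub>C ((R z - R w) * R w)" .
    then have "norm (R z - R w - (z - w) *\<^sub>C (R w * R w)) \<le> norm (z - w) * (norm (R z - R w) * norm (R w))"
      by (simp add: norm_scaleC mult_left_mono norm_mult_ineq)
    then show "norm (R z - R w - (z - w) *\<^sub>C (R w * R w)) / norm (z - w) \<le> norm (R z - R w) * norm (R w)"
      using \<open>z \<noteq> w\<close> by (simp add: divide_le_eq mult.commute)
  qed simp
  moreover have "continuous_on UNIV (\<lambda>w. R w * R w)" by (intro continuous_intros cont)
  moreover have "(R \<longlongrightarrow> 0) at_infinity"
  proof (rule Lim_null_comparison)
    show "\<forall>\<^sub>F \<mu> in at_infinity. norm (R \<mu>) \<le> norm f * inverse (norm \<mu> - norm x)"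
      unfolding eventually_at_infinity
    proof (intro exI[of _ "norm x + 1"] allI impI)
      fix \<mu> :: complex assume \<mu>: "norm x + 1 \<le> norm \<mu>"
      \<comment> \<open>A rewriting of \<open>R \<mu> * (x - \<mu>) = f\<close>; taking norms yields
        the decay at infinity.\<close>
      have "\<mu> *\<^sub>C R \<mu> = R \<mu> * x - f"
        using R(1)[of \<mu>] by (simp add: right_diff_distrib mult_scaleC_right algebra_simps)
      then have "norm \<mu> * norm (R \<mu>) \<le> norm (R \<mu> * x) + norm f"
        by (metis norm_scaleC norm_triangle_ineq4)
      also have "\<dots> \<le> norm (R \<mu>) * norm x + norm f" by (simp add: norm_mult_ineq)
      finally have "norm (R \<mu>) * (norm \<mu> - norm x) \<le> norm f" by (simp add: algebra_simps)
      then show "norm (R \<mu>) \<le> norm f * inverse (norm \<mu> - norm x)"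
        using \<mu> by (simp add: field_simps)
    qed
    have "filterlim (\<lambda>\<mu>::complex. - norm x + norm \<mu>) at_top at_infinity"
      by (intro filterlim_tendsto_add_at_top[OF tendsto_const] filterlim_norm_at_top)
    then have "filterlim (\<lambda>\<mu>::complex. norm \<mu> - norm x) at_top at_infinity" by simp
    then have "((\<lambda>\<mu>::complex. inverse (norm \<mu> - norm x)) \<longlongrightarrow> 0) at_infinity"
      by (rule tendsto_inverse_0_at_top)
    then show "((\<lambda>\<mu>::complex. norm f * inverse (norm \<mu> - norm x)) \<longlongrightarrow> 0) at_infinity"
      by (rule tendsto_mult_right_zero)
  qed
  ultimately have "R 0 = 0" by (rule liouville_vanishing)
  then show ?thesis using R(1)[of 0] by simp
qed


section \<open>Spectrum and poles of the resolvent\<close>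

lemma inverses_uminus: "inverses (- a) (- b) \<longleftrightarrow> inverses a b"
  by (simp add: inverses_def)

lemma not_in_spectrum_iff: "\<mu> \<notin> spectrum x \<longleftrightarrow> (\<exists>b. inverses (x - \<mu> *\<^sub>C 1) b)"
  by (auto simp: spectrum_def Units_def inverses_def)

lemma resolvent_eq:
  assumes "inverses (\<mu> *\<^sub>C 1 - x) b"
  shows "resolvent x \<mu> = b"
proof -
  have "y = b" if "(\<mu> *\<^sub>C 1 - x) * y = 1" for y
    using assms that unfolding inverses_def by (metis mult.assoc mult.left_neutral mult.right_neutral)
  then show ?thesis
    using assms unfolding resolvent_def m_inv_def inverses_def by (auto intro!: the_equality)
qed

lemma inverses_resolvent:
  assumes "\<mu> \<notin> spectrum x"
  shows "inverses (\<mu> *\<^sub>C 1 - x) (resolvent x \<mu>)"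
proof -
  obtain b where "inverses (x - \<mu> *\<^sub>C 1) b" using assms by (auto simp: not_in_spectrum_iff)
  then have "inverses (\<mu> *\<^sub>C 1 - x) (- b)" using inverses_uminus[of "x - \<mu> *\<^sub>C 1" b] by simp
  then show ?thesis using resolvent_eq by metis
qed

text \<open>\<open>a - l = a * (1 - l * b)\<close>, and a Neumann series inverts the second
  factor.\<close>

lemma inverses_perturb:
  fixes a b :: "'a::complex_banach_algebra"
  assumes ab: "inverses a b" and l: "cmod l * norm b < 1"
  shows "\<exists>c. inverses (a - l *\<^sub>C 1) c"
proof -
  define y where "y = l *\<^sub>C b"
  have y: "norm y < 1" using l by (simp add: y_def norm_scaleC)
  have e1: "a - l *\<^sub>C 1 = a * (1 - y)"
    using ab by (simp add: y_def inverses_def right_diff_distrib scaleC_simps)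
  have "(a - l *\<^sub>C 1) * (neumann y * b) = a * ((1 - y) * neumann y) * b"
    by (simp only: e1 mult.assoc)
  moreover have "(neumann y * b) * (a - l *\<^sub>C 1) = neumann y * (b * a) * (1 - y)"
    by (simp only: e1 mult.assoc)
  ultimately show ?thesis
    using ab neumann_left[OF y] neumann_right[OF y] by (intro exI[of _ "neumann y * b"]) (simp add: inverses_def)
qed

lemma closed_spectrum: "closed (spectrum (x :: 'a::complex_banach_algebra))"
proof -
  have "open (- spectrum x)"
    unfolding open_dist
  proof (intro ballI)
    fix \<mu> assume "\<mu> \<in> - spectrum x"
    then obtain b where b: "inverses (x - \<mu> *\<^sub>C 1) b" by (auto simp: not_in_spectrum_iff)
    have pos: "norm b + 1 > 0" by (simp add: add_nonneg_pos)
    have "\<nu> \<in> - spectrum x" if "dist \<nu> \<mu> < 1 / (norm b + 1)" for \<nu>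
    proof -
      have "cmod (\<nu> - \<mu>) * (norm b + 1) < 1"
        using that pos by (simp add: dist_norm pos_less_divide_eq)
      moreover have "cmod (\<nu> - \<mu>) * norm b \<le> cmod (\<nu> - \<mu>) * (norm b + 1)"
        by (intro mult_left_mono) auto
      ultimately have "\<exists>c. inverses (x - \<mu> *\<^sub>C 1 - (\<nu> - \<mu>) *\<^sub>C 1) c"
        by (intro inverses_perturb[OF b]) linarith
      then show ?thesis by (simp add: not_in_spectrum_iff scaleC_diff_left algebra_simps)
    qed
    then show "\<exists>e>0. \<forall>\<nu>. dist \<nu> \<mu> < e \<longrightarrow> \<nu> \<in> - spectrum x"
      using pos by (intro exI[of _ "1 / (norm b + 1)"]) auto
  qed
  then show ?thesis by (simp add: closed_def)
qed

lemma spectrum_norm_le: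
  fixes x :: "'a::complex_banach_algebra"
  assumes "\<mu> \<in> spectrum x"
  shows "cmod \<mu> \<le> norm x"
proof (rule ccontr)
  assume "\<not> cmod \<mu> \<le> norm x"
  then have \<mu>: "norm x < cmod \<mu>" "\<mu> \<noteq> 0" by auto
  define y where "y = (1 / \<mu>) *\<^sub>C x"
  have y: "norm y < 1" using \<mu> by (simp add: y_def norm_scaleC norm_divide)
  have "x - \<mu> *\<^sub>C 1 = (- \<mu>) *\<^sub>C (1 - y)" using \<mu> by (simp add: y_def scaleC_simps)
  moreover have "inverses ((- \<mu>) *\<^sub>C (1 - y)) ((- 1 / \<mu>) *\<^sub>C neumann y)"
    unfolding inverses_def mult_scaleC_left mult_scaleC_right scaleC_scaleC
    using \<mu> by (simp add: neumann_left[OF y] neumann_right[OF y] scaleC_one)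
  ultimately have "inverses (x - \<mu> *\<^sub>C 1) ((- 1 / \<mu>) *\<^sub>C neumann y)" by simp
  then show False using assms not_in_spectrum_iff by blast
qed

lemma compact_spectrum: "compact (spectrum (x :: 'a::complex_banach_algebra))"
  using closed_spectrum spectrum_norm_le unfolding compact_eq_bounded_closed bounded_iff by blast

text \<open>Supplies the small invertible shifts required by
  \<open>b_fredholm_boundary_drazin\<close>.\<close>

lemma frontier_spectrum_approx:
  assumes \<mu>: "\<mu> \<in> frontier (spectrum x)" and "\<epsilon> > 0"
  shows "\<exists>l b. cmod l < \<epsilon> \<and> inverses (x - \<mu> *\<^sub>C 1 - l *\<^sub>C 1) b"
proof -
  have "\<mu> \<notin> interior (spectrum x)" using \<mu> by (simp add: frontier_def)
  then have "\<not> ball \<mu> \<epsilon> \<subseteq> spectrum x" using assms(2) by (auto simp: mem_interior)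
  then obtain \<nu> where "\<nu> \<in> ball \<mu> \<epsilon>" and \<nu>: "\<nu> \<notin> spectrum x" by blast
  then obtain b where "inverses (x - \<nu> *\<^sub>C 1) b" by (auto simp: not_in_spectrum_iff)
  moreover have "x - \<nu> *\<^sub>C 1 = x - \<mu> *\<^sub>C 1 - (\<nu> - \<mu>) *\<^sub>C 1" by (simp add: scaleC_diff_left)
  ultimately show ?thesis using \<open>\<nu> \<in> ball \<mu> \<epsilon>\<close> by (metis dist_commute dist_norm mem_ball)
qed

text \<open>With \<open>q = 1 - a * b\<close> the algebra splits into a part on which \<open>a\<close> is nilpotent and one on
  which \<open>b\<close> inverts it; the resolvent is a finite sum on the first and a Neumann series on the
  second.\<close>

lemma drazin_resolvent:
  fixes a b :: "'a::complex_banach_algebra"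
  assumes d: "drazin_inverse a k b" and t: "t \<noteq> 0" "cmod t * norm b < 1"
  shows "inverses (t *\<^sub>C 1 - a)
    ((\<Sum>n<k. (1 / t ^ Suc n) *\<^sub>C (a ^ n * (1 - a * b))) - b * neumann (t *\<^sub>C b))"
proof -
  define q where "q = 1 - a * b"
  have bab: "b * a * b = b" and ab: "a * b = b * a" and "a ^ k * b * a = a ^ k"
    using d by (auto simp: drazin_inverse_def)
  then have akq: "a ^ k * q = 0" by (simp add: q_def right_diff_distrib mult.assoc)
  have "a * (a * b) = a * (b * a)" by (simp only: ab)
  then have aq: "a * q = q * a" by (simp add: q_def right_diff_distrib left_diff_distrib mult.assoc)
  define S where "S m = (\<Sum>n<m. (1 / t ^ Suc n) *\<^sub>C (a ^ n * q))" for m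
  \<comment> \<open>A telescoping sum; for \<open>m = k\<close> the last term drops out by
    \<open>akq\<close>.\<close>
  have S1: "(t *\<^sub>C 1 - a) * S m = q - (1 / t ^ m) *\<^sub>C (a ^ m * q)" for m
  proof (induction m)
    case (Suc m)
    have "(t *\<^sub>C 1 - a) * S (Suc m) = (t *\<^sub>C 1 - a) * S m + (t *\<^sub>C 1 - a) * ((1 / t ^ Suc m) *\<^sub>C (a ^ m * q))"
      by (simp add: S_def distrib_left)
    also have "(t *\<^sub>C 1 - a) * ((1 / t ^ Suc m) *\<^sub>C (a ^ m * q)) =
        (1 / t ^ m) *\<^sub>C (a ^ m * q) - (1 / t ^ Suc m) *\<^sub>C (a ^ Suc m * q)"
      using t by (simp add: left_diff_distrib scaleC_simps mult.assoc[symmetric])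
    finally show ?case by (simp add: Suc)
  qed (simp add: S_def scaleC_simps)
  have "a ^ m * q * a = a * (a ^ m * q)" for m
  proof -
    have "a ^ m * q * a = a ^ m * a * q" by (simp only: aq mult.assoc)
    then show ?thesis by (simp only: power_commutes mult.assoc)
  qed
  then have "S m * a = a * S m" for m
    by (simp add: S_def sum_distrib_left sum_distrib_right mult_scaleC_left mult_scaleC_right)
  then have S2: "S m * (t *\<^sub>C 1 - a) = (t *\<^sub>C 1 - a) * S m" for m
    by (simp add: left_diff_distrib right_diff_distrib scaleC_simps)
  have Sk: "(t *\<^sub>C 1 - a) * S k = q" by (simp add: S1 akq)
  define N where "N = neumann (t *\<^sub>C b)"
  have nb: "norm (t *\<^sub>C b) < 1" using t by (simp add: norm_scaleC)
  have N1: "N = 1 + t *\<^sub>C (b * N)"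
    using neumann_left[OF nb] by (simp add: N_def left_diff_distrib scaleC_simps algebra_simps)
  have N2: "N = 1 + t *\<^sub>C (N * b)"
    using neumann_right[OF nb] by (simp add: N_def right_diff_distrib scaleC_simps algebra_simps)
  \<comment> \<open>Comparing the two fixed-point equations for \<open>N\<close> and dividing by
    \<open>t\<close> shows that \<open>N\<close> commutes with \<open>b\<close>.\<close>
  have "t *\<^sub>C (b * N) = t *\<^sub>C (N * b)" using N1 N2 by (metis add_left_cancel)
  then have "(1 / t) *\<^sub>C (t *\<^sub>C (b * N)) = (1 / t) *\<^sub>C (t *\<^sub>C (N * b))" by simp
  then have bN: "b * N = N * b" using t by (simp add: scaleC_simps)
  have abb: "a * b * b = b" using bab ab by simp
  have bba: "b * b * a = b" using bab ab by (simp add: mult.assoc)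
  have "a * (b * N) = a * b + t *\<^sub>C ((a * b * b) * N)"
    by (subst N1) (simp add: distrib_left scaleC_simps mult.assoc)
  then have B1: "(t *\<^sub>C 1 - a) * (b * N) = - (a * b)"
    by (simp add: abb left_diff_distrib scaleC_simps)
  have "(b * N) * a = b * a + t *\<^sub>C (N * (b * b * a))"
    unfolding bN by (subst N2) (simp add: distrib_right scaleC_simps mult.assoc)
  then have B2: "(b * N) * (t *\<^sub>C 1 - a) = - (a * b)"
    by (simp add: bba right_diff_distrib scaleC_simps ab bN)
  have "(t *\<^sub>C 1 - a) * (S k - b * N) = 1" "(S k - b * N) * (t *\<^sub>C 1 - a) = 1"
    by (simp_all only: right_diff_distrib[of "t *\<^sub>C 1 - a"] left_diff_distrib[of _ _ "t *\<^sub>C 1 - a"]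
        S2 Sk B1 B2) (simp_all add: q_def)
  then show ?thesis by (simp add: inverses_def S_def q_def N_def)
qed

section \<open>From Drazin inverses to poles\<close>

lemma drazin_inverse_zero: "drazin_inverse a 0 b \<Longrightarrow> inverses a b"
  by (auto simp: drazin_inverse_def inverses_def)

text \<open>\<open>drazin_resolvent\<close> is read as a Laurent expansion in
  \<open>w - \<mu>\<close>: the finite sum is the principal part, the Neumann series the regular
  part.\<close>

lemma drazin_pole:
  assumes d: "drazin_inverse (x - \<mu> *\<^sub>C 1) k b" and \<mu>: "\<mu> \<in> spectrum x"
  shows "\<mu> \<in> resolvent_poles x"
proof -
  define a where "a = x - \<mu> *\<^sub>C 1"
  define q where "q = 1 - a * b"
  have bab: "b * a * b = b" and ab: "a * b = b * a" and "a ^ k * b * a = a ^ k"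
    using d by (auto simp: drazin_inverse_def a_def)
  then have akq: "a ^ k * q = 0" by (simp add: q_def right_diff_distrib mult.assoc)
  \<comment> \<open>The order of the pole is the least such exponent, not the given
    \<open>k\<close>: minimality makes the leading coefficient \<open>a ^ (p - 1) * q\<close>
    nonzero.\<close>
  define p where "p = (LEAST n. a ^ n * q = 0)"
  have pq: "a ^ p * q = 0" unfolding p_def by (rule LeastI[of "\<lambda>n. a ^ n * q = 0" k, OF akq])
  then have dp: "drazin_inverse a p b"
    unfolding drazin_inverse_def using bab ab by (simp add: q_def right_diff_distrib mult.assoc)
  have "p \<noteq> 0"
  proof
    assume "p = 0"
    then have "inverses a b" using dp drazin_inverse_zero by auto
    then show False using \<mu> not_in_spectrum_iff unfolding a_def by blast
  qed
  then have p: "p \<ge> 1" by simp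
  have top: "a ^ (p - 1) * q \<noteq> 0"
    using not_less_Least[of "p - 1" "\<lambda>n. a ^ n * q = 0"] p by (simp add: p_def[symmetric])
  define r where "r = 1 / (norm b + 1)"
  have pos: "norm b + 1 > 0" by (simp add: add_nonneg_pos)
  have r: "r > 0" using pos by (simp add: r_def)
  have small: "cmod t * norm b < 1" if "cmod t < r" for t
  proof -
    have "cmod t * (norm b + 1) < 1" using that pos by (simp add: r_def pos_less_divide_eq)
    moreover have "cmod t * norm b \<le> cmod t * (norm b + 1)" by (intro mult_left_mono) auto
    ultimately show ?thesis by linarith
  qed
  define Rs where "Rs t = (\<Sum>n<p. (1 / t ^ Suc n) *\<^sub>C (a ^ n * q)) - b * neumann (t *\<^sub>C b)" for t
  have inv: "inverses (w *\<^sub>C 1 - x) (Rs (w - \<mu>))" if "w \<noteq> \<mu>" "cmod (w - \<mu>) < r" for w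
  proof -
    have "inverses ((w - \<mu>) *\<^sub>C 1 - a) (Rs (w - \<mu>))"
      using drazin_resolvent[OF dp _ small[OF that(2)]] that(1) by (simp add: Rs_def q_def)
    then show ?thesis by (simp add: a_def scaleC_diff_left)
  qed
  have "\<mu> isolated_in spectrum x"
    unfolding isolated_in_dist_Ex_iff
  proof (intro conjI exI[of _ r] r \<mu> ballI impI)
    fix w assume w: "w \<in> spectrum x" "dist \<mu> w < r"
    show "w = \<mu>"
    proof (rule ccontr)
      assume "w \<noteq> \<mu>"
      then have "inverses (w *\<^sub>C 1 - x) (Rs (w - \<mu>))"
        using w inv[of w] by (simp add: dist_norm norm_minus_commute)
      then have "inverses (x - w *\<^sub>C 1) (- Rs (w - \<mu>))"
        using inverses_uminus[of "w *\<^sub>C 1 - x"] by fastforce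
      then show False using w not_in_spectrum_iff by blast
    qed
  qed
  moreover have "has_pole_at (resolvent x) \<mu>"
    unfolding has_pole_at_def
  \<comment> \<open>Index \<open>n\<close> belongs to the power \<open>n - p\<close>, so the
    principal part is listed in reverse order and the regular part starts at \<open>n = p\<close>
    with \<open>- b\<close>.\<close>
  proof (intro exI[of _ p] exI[of _ r] exI[of _ "\<lambda>n. if n < p then a ^ (p - Suc n) * q else - (b ^ (Suc n - p))"] conjI r p ballI)
    show "(if 0 < p then a ^ (p - Suc 0) * q else - (b ^ (Suc 0 - p))) \<noteq> 0"
      using p top by simp
    fix w assume "w \<in> ball \<mu> r - {\<mu>}"
    then have w: "w \<noteq> \<mu>" "cmod (w - \<mu>) < r" by (auto simp: dist_norm norm_minus_commute)
    define t where "t = w - \<mu>"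
    have t0: "t \<noteq> 0" using w by (simp add: t_def)
    define F where "F n = ((w - \<mu>) powi (int n - int p)) *\<^sub>C
      (if n < p then a ^ (p - Suc n) * q else - (b ^ (Suc n - p)))" for n
    have "(\<lambda>n. F (n + p)) = (\<lambda>n. - (b * (t *\<^sub>C b) ^ n))"
      by (simp add: F_def t_def[symmetric] fun_eq_iff power_scaleC mult_scaleC_right scaleC_minus_right)
    moreover have "(\<lambda>n. - (b * (t *\<^sub>C b) ^ n)) sums - (b * neumann (t *\<^sub>C b))"
      using summable_power[of "t *\<^sub>C b"] small[of t] w
      by (intro sums_minus sums_mult) (simp add: neumann_def summable_sums norm_scaleC t_def)
    moreover have "(\<Sum>n<p. F n) = (\<Sum>n<p. (1 / t ^ Suc n) *\<^sub>C (a ^ n * q))"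
    proof -
      have "(\<Sum>n<p. (1 / t ^ Suc n) *\<^sub>C (a ^ n * q)) = (\<Sum>n<p. (1 / t ^ Suc (p - Suc n)) *\<^sub>C (a ^ (p - Suc n) * q))"
        by (rule sum.nat_diff_reindex[symmetric])
      also have "\<dots> = (\<Sum>n<p. F n)"
      proof (rule sum.cong)
        fix n assume "n \<in> {..<p}"
        then have n: "n < p" by simp
        then have "int n - int p = - int (Suc (p - Suc n))" by simp
        then have "t powi (int n - int p) = 1 / t ^ Suc (p - Suc n)"
          by (simp only: power_int_minus power_int_of_nat inverse_eq_divide)
        then show "(1 / t ^ Suc (p - Suc n)) *\<^sub>C (a ^ (p - Suc n) * q) = F n"
          using n by (simp add: F_def t_def)
      qed simp
      finally show ?thesis by simp
    qed
    ultimately have "(\<lambda>n. F (n + p)) sums (Rs t - (\<Sum>n<p. F n))" by (simp add: Rs_def)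
    then have "F sums Rs t" by (simp add: sums_iff_shift)
    moreover have "resolvent x w = Rs t" using resolvent_eq inv[OF w] by (simp add: t_def)
    ultimately show "(\<lambda>n. ((w - \<mu>) powi (int n - int p)) *\<^sub>C
        (if n < p then a ^ (p - Suc n) * q else - (b ^ (Suc n - p)))) sums resolvent x w"
      by (simp add: F_def[abs_def])
  qed
  ultimately show ?thesis by (simp add: resolvent_poles_def)
qed

section \<open>From poles to Drazin inverses\<close>

text \<open>Convergence at \<open>s\<close> bounds the terms by some \<open>K\<close>. At
  \<open>\<theta> * s\<close> the tail after \<open>e 0\<close> is then at most
  \<open>2 * K * \<theta>\<close>, which tends to \<open>0\<close>.\<close>

lemma power_series_zero_first:
  fixes e :: "nat \<Rightarrow> 'a::complex_banach_algebra"
  assumes "\<rho> > 0" and e: "\<And>t. 0 < cmod t \<Longrightarrow> cmod t < \<rho> \<Longrightarrow> (\<lambda>n. t ^ n *\<^sub>C e n) sums 0"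
  shows "e 0 = 0"
proof -
  define s where "s = \<rho> / 2"
  have s: "s > 0" "s < \<rho>" using assms(1) by (auto simp: s_def)
  have "summable (\<lambda>n. (of_real s) ^ n *\<^sub>C e n)" using e[of "of_real s"] s by (auto simp: sums_iff)
  then obtain K where "\<And>n. norm ((of_real s) ^ n *\<^sub>C e n) \<le> K"
    using summable_imp_Bseq BseqE by metis
  then have K: "s ^ n * norm (e n) \<le> K" for n
    using s by (simp add: norm_scaleC norm_power) 
  have "norm (e 0) \<le> K" using K[of 0] by simp
  then have "K \<ge> 0" by (rule order_trans[OF norm_ge_zero])
  have "norm (e 0) \<le> 2 * K * \<theta>" if \<theta>: "0 < \<theta>" "\<theta> \<le> 1/2" for \<theta>
  proof -
    define t where "t = complex_of_real (\<theta> * s)"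
    have "\<theta> * s < 1 * \<rho>" using \<theta> s by (intro mult_strict_mono) auto
    then have "(\<lambda>n. t ^ n *\<^sub>C e n) sums 0" using \<theta> s by (intro e) (auto simp: t_def norm_mult)
    then have "(\<lambda>n. t ^ Suc n *\<^sub>C e (Suc n)) sums (0 - e 0)"
      using sums_Suc_iff[of "\<lambda>n. t ^ n *\<^sub>C e n" "- e 0"] by (simp add: scaleC_one)
    then have "- e 0 = (\<Sum>n. t ^ Suc n *\<^sub>C e (Suc n))" by (simp add: sums_iff)
    then have "norm (e 0) = norm (\<Sum>n. t ^ Suc n *\<^sub>C e (Suc n))" by (metis norm_minus_cancel)
    also have "\<dots> \<le> (\<Sum>n. K * \<theta> * \<theta> ^ n)"
    proof (rule norm_suminf_le)
      show "summable (\<lambda>n. K * \<theta> * \<theta> ^ n)" using \<theta> by (intro summable_mult summable_geometric) auto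
      fix n
      have "norm (t ^ Suc n *\<^sub>C e (Suc n)) = \<theta> ^ Suc n * (s ^ Suc n * norm (e (Suc n)))"
        using \<theta> s by (simp add: norm_scaleC norm_mult norm_power t_def power_mult_distrib)
      also have "\<dots> \<le> \<theta> ^ Suc n * K" using \<theta> by (intro mult_left_mono K) auto
      finally show "norm (t ^ Suc n *\<^sub>C e (Suc n)) \<le> K * \<theta> * \<theta> ^ n" by (simp add: mult_ac)
    qed
    also have "\<dots> = K * \<theta> * (1 / (1 - \<theta>))"
      using \<theta> by (subst suminf_mult) (auto simp: suminf_geometric summable_geometric)
    also have "\<dots> \<le> K * \<theta> * 2"
      using \<theta> \<open>K \<ge> 0\<close> by (intro mult_left_mono) (auto simp: field_simps)
    finally show ?thesis by (simp add: mult_ac)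
  qed
  then have ev: "\<forall>\<^sub>F \<theta> in at_right 0. norm (e 0) \<le> 2 * K * \<theta>"
    by (intro eventually_at_rightI[of 0 "1/2"]) auto
  have "norm (e 0) \<le> 0"
  proof (rule tendsto_le[OF _ _ _ ev])
    show "((\<lambda>\<theta>. 2 * K * \<theta>) \<longlongrightarrow> 0) (at_right 0)"
      by (rule tendsto_eq_intros refl tendsto_ident_at)+ simp
  qed simp_all
  then show ?thesis by simp
qed

text \<open>Once the constant term is zero, dividing by \<open>t\<close> shifts the series and the
  previous case applies again.\<close>

lemma power_series_zero:
  fixes e :: "nat \<Rightarrow> 'a::complex_banach_algebra"
  assumes "\<rho> > 0" and e: "\<And>t. 0 < cmod t \<Longrightarrow> cmod t < \<rho> \<Longrightarrow> (\<lambda>n. t ^ n *\<^sub>C e n) sums 0"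
  shows "e n = 0"
  using e
proof (induction n arbitrary: e)
  case 0
  then show ?case by (rule power_series_zero_first[OF assms(1)])
next
  case (Suc n)
  have e0: "e 0 = 0" by (rule power_series_zero_first[OF assms(1) Suc.prems])
  have "(\<lambda>n. t ^ n *\<^sub>C e (Suc n)) sums 0" if t: "0 < cmod t" "cmod t < \<rho>" for t
  proof -
    have "(\<lambda>n. t ^ Suc n *\<^sub>C e (Suc n)) sums 0"
      using Suc.prems[OF t] sums_Suc_iff[of "\<lambda>n. t ^ n *\<^sub>C e n" 0] e0 by simp
    from bounded_linear.sums[OF bounded_linear_scaleC_right this, of "1 / t"]
    show ?thesis using t by (simp add: scaleC_simps)
  qed
  then show ?case by (rule Suc.IH)
qed

text \<open>Iteration gives \<open>a ^ p = a ^ p * a ^ p * b ^ p\<close>, so \<open>b ^ p\<close>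
  serves as both \<open>v\<close> and \<open>w\<close>. The Drazin inverse obtained may differ from
  the given \<open>b\<close>.\<close>

lemma drazin_of_commuting:
  fixes a b :: "'a::ring_1"
  assumes ab: "a * b = b * a" and p: "a ^ p * (a * b) = a ^ p" "p \<ge> 1"
  shows "\<exists>b. drazin_inverse a p b"
proof (rule drazin_of_strongly_pi_regular[OF _ _ p(2)])
  have eq: "a ^ p = a ^ p * (a ^ n * b ^ n)" for n
  proof (induction n)
    case (Suc n)
    have "a ^ p * (a ^ Suc n * b ^ Suc n) = a ^ p * (a ^ n * ((a * b) * b ^ n))"
      by (simp only: power_Suc2[of a] power_Suc[of b] mult.assoc)
    also have "\<dots> = (a ^ p * a ^ n * (a * b)) * b ^ n" by (simp only: mult.assoc)
    also have "a ^ p * a ^ n * (a * b) = a ^ n * (a ^ p * (a * b))"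
      by (simp only: mult.assoc[symmetric] power_add[symmetric] add.commute)
    also have "\<dots> = a ^ p * a ^ n" by (simp only: p power_add[symmetric] add.commute)
    finally show ?case using Suc by (simp add: mult.assoc)
  qed simp
  then show v: "a ^ p = a ^ p * a ^ p * b ^ p" by (simp add: mult.assoc)
  have "a ^ p * b ^ p = b ^ p * a ^ p" by (metis ab power_commuting_commutes)
  then show "a ^ p = b ^ p * a ^ p * a ^ p"
    using v power_commuting_commutes[of "b ^ p" "a ^ p" 1] by (metis mult.assoc)
qed

text \<open>The identities \<open>(t - a) * R = 1\<close> and \<open>R * (t - a) = 1\<close> are
  multiplied by \<open>t ^ p\<close>, and the coefficients of the resulting power series are
  compared.\<close>

lemma pole_drazin:
  assumes \<mu>: "\<mu> \<in> resolvent_poles x"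
  shows "\<exists>k b. drazin_inverse (x - \<mu> *\<^sub>C 1) k b"
proof -
  define a where "a = x - \<mu> *\<^sub>C 1"
  obtain e where e: "e > 0" "\<And>w. w \<in> spectrum x \<Longrightarrow> dist \<mu> w < e \<Longrightarrow> w = \<mu>"
    using \<mu> isolated_inE_dist unfolding resolvent_poles_def by (metis mem_Collect_eq)
  obtain p c r where p: "p \<ge> (1::nat)" and r: "r > 0" and
    c: "\<And>w. w \<in> ball \<mu> r - {\<mu>} \<Longrightarrow> (\<lambda>n. ((w - \<mu>) powi (int n - int p)) *\<^sub>C c n) sums resolvent x w"
    using \<mu> unfolding resolvent_poles_def has_pole_at_def by blast
  define \<rho> where "\<rho> = min r e"
  have \<rho>: "\<rho> > 0" using r e by (simp add: \<rho>_def)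
  \<comment> \<open>Multiplying the series by \<open>t\<close> shifts the coefficients; index
    \<open>0\<close> receives \<open>0\<close>.\<close>
  define c' where "c' n = (if n = 0 then 0 else c (n - 1))" for n
  have key: "(\<lambda>n. t ^ n *\<^sub>C (c' n - a * c n - (if n = p then 1 else 0))) sums 0"
       "(\<lambda>n. t ^ n *\<^sub>C (c' n - c n * a - (if n = p then 1 else 0))) sums 0"
    if t: "0 < cmod t" "cmod t < \<rho>" for t
  proof -
    define w where "w = \<mu> + t"
    have w: "w \<in> ball \<mu> r - {\<mu>}" "w \<notin> spectrum x"
      using t e(2)[of w] by (auto simp: w_def dist_norm \<rho>_def)
    define R where "R = resolvent x w"
    have "w *\<^sub>C 1 - x = t *\<^sub>C 1 - a" by (simp add: w_def a_def scaleC_simps)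
    then have "inverses (t *\<^sub>C 1 - a) R" using inverses_resolvent[OF w(2)] by (simp add: R_def)
    then have R: "t *\<^sub>C R - a * R = 1" "t *\<^sub>C R - R * a = 1"
      by (simp_all add: inverses_def left_diff_distrib right_diff_distrib scaleC_simps)
    have Laurent: "(\<lambda>n. (t powi (int n - int p)) *\<^sub>C c n) sums R" using c[OF w(1)] by (simp add: w_def R_def)
    have g: "(\<lambda>n. t ^ n *\<^sub>C c n) sums (t ^ p *\<^sub>C R)"
    proof -
      have "t ^ p * t powi (int n - int p) = t ^ n" for n
        using t by (simp add: power_int_diff power_int_of_nat)
      then show ?thesis
        using bounded_linear.sums[OF bounded_linear_scaleC_right Laurent, of "t ^ p"]
        by (simp add: scaleC_scaleC)
    qed
    have g': "(\<lambda>n. t ^ n *\<^sub>C c' n) sums (t ^ p *\<^sub>C (t *\<^sub>C R))"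
    proof -
      have "(\<lambda>n. t ^ Suc n *\<^sub>C c' (Suc n)) sums (t ^ p *\<^sub>C (t *\<^sub>C R))"
        using bounded_linear.sums[OF bounded_linear_scaleC_right g, of t]
        by (simp add: c'_def scaleC_scaleC mult.commute)
      then show ?thesis using sums_Suc_iff[of "\<lambda>n. t ^ n *\<^sub>C c' n"] by (simp add: c'_def)
    qed
    have one: "(\<lambda>n. t ^ n *\<^sub>C (if n = p then 1 else 0 :: 'a)) sums (t ^ p *\<^sub>C 1)"
    proof -
      have "(\<lambda>n. t ^ n *\<^sub>C (if n = p then 1 else 0 :: 'a)) = (\<lambda>n. if n = p then t ^ n *\<^sub>C 1 else 0)"
        by (auto simp: fun_eq_iff)
      then show ?thesis using sums_single[of p "\<lambda>n. t ^ n *\<^sub>C (1::'a)"] by simp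
    qed
    have zl: "t ^ p *\<^sub>C (t *\<^sub>C R) - t ^ p *\<^sub>C (a * R) - t ^ p *\<^sub>C 1 = 0"
      using R by (simp only: scaleC_diff_right[symmetric]) simp
    have zr: "t ^ p *\<^sub>C (t *\<^sub>C R) - t ^ p *\<^sub>C (R * a) - t ^ p *\<^sub>C 1 = 0"
      using R by (simp only: scaleC_diff_right[symmetric]) simp
    have gl: "(\<lambda>n. t ^ n *\<^sub>C (a * c n)) sums (t ^ p *\<^sub>C (a * R))"
      using sums_mult[OF g, of a] by (simp add: mult_scaleC_right)
    have gr: "(\<lambda>n. t ^ n *\<^sub>C (c n * a)) sums (t ^ p *\<^sub>C (R * a))"
      using sums_mult2[OF g, of a] by (simp add: mult_scaleC_left)
    show "(\<lambda>n. t ^ n *\<^sub>C (c' n - a * c n - (if n = p then 1 else 0))) sums 0"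
      using sums_diff[OF sums_diff[OF g' gl] one] by (simp only: zl scaleC_diff_right)
    show "(\<lambda>n. t ^ n *\<^sub>C (c' n - c n * a - (if n = p then 1 else 0))) sums 0"
      using sums_diff[OF sums_diff[OF g' gr] one] by (simp only: zr scaleC_diff_right)
  qed
  have cl: "c' n - a * c n - (if n = p then 1 else 0) = 0" for n
    by (rule power_series_zero[OF \<rho> key(1)])
  have cr: "c' n - c n * a - (if n = p then 1 else 0) = 0" for n
    by (rule power_series_zero[OF \<rho> key(2)])
  \<comment> \<open>Below index \<open>p\<close> the recurrence is homogeneous: \<open>a\<close>
    lowers the index of \<open>c\<close> and kills \<open>c 0\<close>.\<close>
  have low: "a ^ Suc j * c j = 0" if "j < p" for j
    using that
  proof (induction j)
    case 0
    then show ?case using cl[of 0] p by (simp add: c'_def)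
  next
    case (Suc j)
    have "a * c (Suc j) = c j" using cl[of "Suc j"] Suc.prems by (simp add: c'_def)
    then have "a ^ Suc (Suc j) * c (Suc j) = a ^ Suc j * c j"
      by (simp only: power_Suc2[of a "Suc j"] mult.assoc)
    then show ?case using Suc by simp
  qed
  \<comment> \<open>At index \<open>p\<close> the recurrence says that \<open>a * b\<close> and
    \<open>b * a\<close> both equal \<open>1\<close> minus the residue \<open>c (p - 1)\<close>,
    which \<open>a ^ p\<close> kills.\<close>
  define b where "b = - c p"
  have ab: "a * b = 1 - c (p - 1)" using cl[of p] p by (simp add: b_def c'_def algebra_simps)
  have ba: "b * a = 1 - c (p - 1)" using cr[of p] p by (simp add: b_def c'_def algebra_simps)
  have "a ^ p * c (p - 1) = 0" using low[of "p - 1"] p by simp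
  then have "a ^ p * (a * b) = a ^ p" by (simp add: ab right_diff_distrib)
  then show ?thesis using drazin_of_commuting[of a b p] ab ba p by (auto simp: a_def)
qed


section \<open>Algebraic elements\<close>

lemma poly_eval_0 [simp]: "poly_eval 0 x = 0"
  by (simp add: poly_eval_def)

lemma poly_eval_pCons [simp]: "poly_eval (pCons c P) x = c *\<^sub>C 1 + x * poly_eval P x"
proof (cases "P = 0")
  case False
  then show ?thesis
    by (simp add: poly_eval_def degree_pCons_eq sum.atMost_Suc_shift sum_distrib_left mult_scaleC_right
        del: sum.atMost_Suc)
qed (simp add: poly_eval_def)

lemma poly_eval_add: "poly_eval (P + Q) x = poly_eval P x + poly_eval Q x"
  by (induction P Q rule: poly_induct2) (simp_all add: scaleC_simps algebra_simps)

lemma poly_eval_smult: "poly_eval (Polynomial.smult c P) x = c *\<^sub>C poly_eval P x"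
  by (induction P) (simp_all add: scaleC_simps)

lemma poly_eval_mult: "poly_eval (P * Q) x = poly_eval P x * poly_eval Q x"
  by (induction P) (simp_all add: poly_eval_add poly_eval_smult mult_scaleC_left distrib_right mult.assoc)

lemma poly_eval_linear_power: "poly_eval ([:- \<mu>, 1:] ^ k) x = (x - \<mu> *\<^sub>C 1) ^ k"
proof (induction k)
  case 0
  then show ?case by (simp add: one_pCons scaleC_simps)
next
  case (Suc k)
  have "poly_eval [:- \<mu>, 1:] x = x - \<mu> *\<^sub>C 1" by (simp add: scaleC_simps)
  then show ?case using Suc by (simp only: power_Suc poly_eval_mult)
qed

text \<open>Write \<open>P = (X - \<mu>) ^ k * Q\<close> and \<open>Q = (X - \<mu>) * T + c\<close>
  with \<open>c\<close> nonzero. Then \<open>P(x) = 0\<close> reads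
  \<open>y ^ k * (y * T(x) + c) = 0\<close>, so \<open>b = - T(x) / c\<close> satisfies
  \<open>y ^ k * (y * b) = y ^ k\<close>.\<close>

lemma algebraic_drazin:
  assumes "algebraic_element x"
  shows "\<exists>k b. drazin_inverse (x - \<mu> *\<^sub>C 1) k b"
proof -
  obtain P where P: "P \<noteq> 0" "poly_eval P x = 0" using assms by (auto simp: algebraic_element_def)
  define y where "y = x - \<mu> *\<^sub>C 1"
  define k where "k = Polynomial.order \<mu> P"
  obtain Q where Q: "P = [:- \<mu>, 1:] ^ k * Q" "\<not> [:- \<mu>, 1:] dvd Q"
    using order_decomp[OF P(1)] unfolding k_def by blast
  define c where "c = poly Q \<mu>"
  have c: "c \<noteq> 0" using Q(2) by (simp add: c_def poly_eq_0_iff_dvd)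
  define T where "T = synthetic_div Q \<mu>"
  have QT: "Q = [:- \<mu>, 1:] * T + [:c:]"
    unfolding T_def c_def by (rule synthetic_div_correct'[symmetric])
  define b where "b = (- 1 / c) *\<^sub>C poly_eval T x"
  have lin: "poly_eval [:- \<mu>, 1:] x = y" by (simp add: y_def scaleC_simps)
  have "y * poly_eval T x = poly_eval T x * y"
    using poly_eval_mult[of "[:- \<mu>, 1:]" T x] poly_eval_mult[of T "[:- \<mu>, 1:]" x]
    by (simp only: lin mult.commute[of T])
  then have yb: "y * b = b * y" by (simp add: b_def mult_scaleC_left mult_scaleC_right)
  have "0 = y ^ k * (y * poly_eval T x + c *\<^sub>C 1)"
    using P(2) unfolding Q(1) QT poly_eval_mult poly_eval_add lin poly_eval_linear_power
    by (simp add: y_def)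
  then have "(- 1 / c) *\<^sub>C (y ^ k * (y * poly_eval T x + c *\<^sub>C 1)) = 0" by simp
  then have "y ^ k * (y * b) - y ^ k = 0"
    using c by (simp add: b_def distrib_left scaleC_simps)
  then have "y ^ k * (y * b) = y ^ k" by simp
  \<comment> \<open>\<open>k\<close> is \<open>0\<close> when \<open>\<mu>\<close> is not a root of
    \<open>P\<close>, while \<open>drazin_of_commuting\<close> wants a positive exponent.\<close>
  then have "y ^ Suc k * (y * b) = y ^ Suc k" by (simp add: mult.assoc)
  then show ?thesis using drazin_of_commuting[OF yb] by (metis y_def le_add1 plus_1_eq_Suc)
qed

text \<open>The idempotent \<open>e\<close> factors through \<open>a ^ k\<close> on the left and on
  the right, and \<open>z\<close> commutes with \<open>a ^ k\<close>; hence \<open>z * e\<close> and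
  \<open>e * z\<close> both equal \<open>e * z * e\<close>. In \<open>split_off_poles\<close> this
  makes the idempotents of different eigenvalues commute.\<close>

lemma drazin_idempotent_commutes:
  fixes a b z :: "'a::ring_1"
  assumes d: "drazin_inverse a k b" and z: "z * a = a * z"
  shows "z * (a * b) = (a * b) * z"
proof -
  have bab: "b * a * b = b" and ab: "a * b = b * a" and k: "a ^ k * b * a = a ^ k"
    using d by (auto simp: drazin_inverse_def)
  define e where "e = a * b"
  have ee: "e * e = e"
  proof -
    have "e * e = a * (b * a * b)" by (simp only: e_def mult.assoc)
    then show ?thesis by (simp only: bab e_def)
  qed
  have ae: "a * e = e * a" 
  proof -
    have "a * e = a * (b * a)" by (simp only: e_def ab)
    then show ?thesis by (simp only: e_def mult.assoc)
  qed
  have eb: "e * b = b" using bab by (simp only: e_def ab)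
  have ake: "a ^ k * e = a ^ k" using k by (simp only: e_def ab mult.assoc)
  have eak: "e * a ^ k = a ^ k" using ake power_commuting_commutes[OF ae, of k] by simp
  have zak: "a ^ k * z = z * a ^ k" by (rule power_commuting_commutes[OF z[symmetric]])
  have pow: "a ^ n * b ^ n * e = e" for n
  proof (induction n)
    case (Suc n)
    have "a ^ Suc n * b ^ Suc n * e = a ^ n * (a * b) * b ^ n * e"
      by (simp only: power_Suc2[of a] power_Suc[of b] mult.assoc)
    also have "\<dots> = a ^ n * (e * b ^ n) * e" by (simp only: e_def mult.assoc)
    also have "e * b ^ n = b ^ n * e"
    proof -
      have "b * e = e * b" by (simp only: e_def ab mult.assoc)
      then show ?thesis by (rule power_commuting_commutes[symmetric])
    qed
    finally show ?case using Suc ee by (simp add: mult.assoc)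
  qed simp
  have be: "b ^ n * a ^ n = a ^ n * b ^ n" for n
  proof -
    have "b ^ n * a = a * b ^ n" by (rule power_commuting_commutes) (simp add: ab)
    then show ?thesis by (metis power_commuting_commutes)
  qed
  have e_left: "e = a ^ k * (b ^ k * e)" using pow[of k] by (simp only: mult.assoc)
  have "e * b ^ k = b ^ k * e"
    by (rule power_commuting_commutes[symmetric]) (simp only: e_def ab mult.assoc)
  then have "e * (b ^ k * a ^ k) = e"
    using pow[of k] by (simp only: be mult.assoc[symmetric]) (metis ake be eak mult.assoc)
  then have e_right: "e = (e * b ^ k) * a ^ k" by (simp only: mult.assoc)
  have "z * e = a ^ k * z * (b ^ k * e)" by (subst e_left) (simp only: zak mult.assoc)
  then have ze: "e * (z * e) = z * e" by (simp only: mult.assoc[symmetric] eak)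
  have "e * z = (e * b ^ k) * z * a ^ k" by (subst e_right) (simp only: zak mult.assoc)
  then have "(e * z) * e = e * z" by (simp only: mult.assoc ake)
  then show ?thesis using ze by (simp add: e_def mult.assoc)
qed

text \<open>One eigenvalue after the other is split off: \<open>f\<close> is the product of the idempotents
  \<open>a * b\<close> over the eigenvalues treated so far.\<close>

lemma split_off_poles:
  fixes x :: "'a::complex_banach_algebra"
  assumes "finite F"
    and "\<And>\<mu>. \<mu> \<in> F \<Longrightarrow> \<exists>k b. drazin_inverse (x - \<mu> *\<^sub>C 1) k b"
  shows "\<exists>f P. P \<noteq> 0 \<and> poly_eval P x * (1 - f) = 0 \<and> f * f = f \<and> (\<forall>z. z * x = x * z \<longrightarrow> z * f = f * z)
    \<and> (\<forall>\<mu>. \<mu> \<in> F \<or> \<mu> \<notin> spectrum x \<longrightarrow> (\<exists>y. corner_inverse f (x - \<mu> *\<^sub>C 1) y))"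
  using assms
proof (induction F)
  case empty
  have "\<exists>y. corner_inverse 1 (x - \<mu> *\<^sub>C 1) y" if "\<mu> \<notin> spectrum x" for \<mu>
    using that by (auto simp: not_in_spectrum_iff inverses_def corner_inverse_def)
  \<comment> \<open>The witness \<open>1\<close> serves for \<open>f\<close> and for
    \<open>P\<close>: before any eigenvalue is treated, the corner is the whole algebra.\<close>
  then show ?case by (intro exI[of _ 1]) auto
next
  case (insert \<nu> F)
  then obtain f P where P: "P \<noteq> 0" "poly_eval P x * (1 - f) = 0" and ff: "f * f = f"
    and fc: "\<And>z. z * x = x * z \<Longrightarrow> z * f = f * z"
    and ci: "\<And>\<mu>. \<mu> \<in> F \<or> \<mu> \<notin> spectrum x \<Longrightarrow> \<exists>y. corner_inverse f (x - \<mu> *\<^sub>C 1) y"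
    by (metis insertCI)
  define a where "a = x - \<nu> *\<^sub>C 1"
  obtain k b where d: "drazin_inverse a k b" using insert.prems unfolding a_def by blast
  have bab: "b * a * b = b" and ab: "a * b = b * a" and k: "a ^ k * b * a = a ^ k"
    using d by (auto simp: drazin_inverse_def)
  define e where "e = a * b"
  have comm_shift: "z * (x - \<mu> *\<^sub>C 1) = (x - \<mu> *\<^sub>C 1) * z \<longleftrightarrow> z * x = x * z" for z \<mu>
    by (simp add: left_diff_distrib right_diff_distrib mult_scaleC_left mult_scaleC_right)
  have ec: "z * e = e * z" if "z * x = x * z" for z
    unfolding e_def using drazin_idempotent_commutes[OF d] that comm_shift unfolding a_def by blast
  have ee: "e * e = e"
  proof -
    have "e * e = a * (b * a * b)" by (simp only: e_def mult.assoc)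
    then show ?thesis by (simp only: bab e_def)
  qed
  have eb: "e * b = b" using bab by (simp only: e_def ab)
  have be: "b * e = b" using bab by (simp only: e_def mult.assoc)
  have xf: "x * f = f * x" using fc by simp
  have xe: "x * e = e * x" using ec by simp
  have fe: "f * e = e * f" using ec[OF xf[symmetric]] .
  define g where "g = f * e"
  have gg: "g * g = g"
  proof -
    have "g * g = f * (e * f) * e" by (simp only: g_def mult.assoc)
    also have "\<dots> = (f * f) * (e * e)" by (simp only: fe[symmetric] mult.assoc)
    finally show ?thesis by (simp only: ff ee g_def)
  qed
  have gc: "z * g = g * z" if "z * x = x * z" for z
  proof -
    have "z * g = (f * z) * e" by (simp only: g_def fc[OF that, symmetric] mult.assoc)
    then show ?thesis by (simp only: g_def ec[OF that] mult.assoc)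
  qed
  have old: "\<exists>y. corner_inverse g (x - \<mu> *\<^sub>C 1) y" if \<mu>: "\<mu> \<in> F \<or> \<mu> \<notin> spectrum x" for \<mu>
  proof -
    define m where "m = x - \<mu> *\<^sub>C 1"
    obtain y where y: "y * m = f" "m * y = f" "f * y = y" "y * f = y"
      using ci[OF \<mu>] by (auto simp: corner_inverse_def m_def)
    have "y * x = x * y" using y comm_shift[of y \<mu>] by (simp add: m_def)
    then have ye: "y * e = e * y" by (rule ec)
    have em: "e * m = m * e" using xe comm_shift[of e \<mu>] by (simp add: m_def)
    have "y * e * m = y * m * e" by (simp only: em mult.assoc)
    moreover have "m * (y * e) = m * y * e" by (simp only: mult.assoc)
    moreover have "g * (y * e) = f * y * (e * e)"
    proof -
      have "g * (y * e) = f * (e * y) * e" by (simp only: g_def mult.assoc)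
      then show ?thesis by (simp only: ye[symmetric] mult.assoc)
    qed
    moreover have "y * e * g = y * f * (e * e)"
    proof -
      have "y * e * g = y * (e * f) * e" by (simp only: g_def mult.assoc)
      then show ?thesis by (simp only: fe[symmetric] mult.assoc)
    qed
    ultimately have "corner_inverse g m (y * e)"
      unfolding corner_inverse_def by (simp only: y ee g_def)
    then show ?thesis unfolding m_def by blast
  qed
  have af: "f * a = a * f" using comm_shift[of f \<nu>] xf by (simp add: a_def)
  \<comment> \<open>In the corner of \<open>g\<close> the Drazin inverse provides an inverse of
    \<open>a\<close>, so \<open>\<nu>\<close> leaves the spectrum there.\<close>
  have new: "corner_inverse g a (f * b)"
  proof -
    have "f * b * a = g" by (simp only: g_def e_def ab mult.assoc)
    moreover have "a * (f * b) = f * a * b" by (simp only: af mult.assoc)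
    moreover have "g * (f * b) = f * b"
    proof -
      have "g * (f * b) = f * (e * f) * b" by (simp only: g_def mult.assoc)
      also have "\<dots> = (f * f) * (e * b)" by (simp only: fe[symmetric] mult.assoc)
      finally show ?thesis by (simp only: ff eb)
    qed
    moreover have "f * b * g = f * b"
    proof -
      have bf: "f * b = b * f"
      proof -
        have "f * b = (f * e) * b" by (simp only: eb mult.assoc)
        also have "\<dots> = e * f * b" by (simp only: fe)
        also have "\<dots> = b * (a * f) * b" by (simp only: e_def ab mult.assoc)
        also have "\<dots> = b * f * e" by (simp only: af[symmetric] e_def mult.assoc)
        also have "\<dots> = (b * e) * f" by (simp only: fe mult.assoc)
        finally show ?thesis by (simp only: be)
      qed
      have "f * b * g = b * (f * f) * e" by (simp only: bf g_def mult.assoc)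
      also have "\<dots> = (b * e) * f" by (simp only: ff fe mult.assoc)
      finally show ?thesis by (simp only: be bf)
    qed
    ultimately show ?thesis unfolding corner_inverse_def by (simp add: g_def e_def mult.assoc)
  qed
  \<comment> \<open>The old factor kills \<open>1 - f\<close> and the new one kills
    \<open>1 - e\<close>; \<open>1 - g\<close> is the sum of \<open>1 - f\<close> and
    \<open>f * (1 - e)\<close>.\<close>
  define P' where "P' = P * [:- \<nu>, 1:] ^ k"
  have "P' \<noteq> 0" using P(1) by (simp add: P'_def)
  moreover have "poly_eval P' x * (1 - g) = 0"
  proof -
    have ev: "poly_eval P' x = poly_eval P x * a ^ k"
      by (simp only: P'_def poly_eval_mult poly_eval_linear_power a_def)
    have ev': "poly_eval P' x = a ^ k * poly_eval P x"
      by (simp only: P'_def mult.commute[of P] poly_eval_mult poly_eval_linear_power a_def)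
    have "a ^ k * f = f * a ^ k" by (rule power_commuting_commutes) (rule af[symmetric])
    then have "poly_eval P' x * (f * (1 - e)) = poly_eval P x * f * (a ^ k * (1 - e))"
      by (simp only: ev mult.assoc[symmetric]) (simp only: mult.assoc)
    also have "a ^ k * (1 - e) = 0"
      using k by (simp add: right_diff_distrib e_def ab mult.assoc)
    finally have "poly_eval P' x * (f * (1 - e)) = 0" by simp
    moreover have "poly_eval P' x * (1 - f) = 0" using P(2) by (simp only: ev' mult.assoc) simp
    moreover have "1 - g = (1 - f) + f * (1 - e)" by (simp add: g_def right_diff_distrib)
    ultimately show ?thesis by (simp only: distrib_left add_0_left)
  qed
  moreover have "\<exists>y. corner_inverse g (x - \<mu> *\<^sub>C 1) y" if "\<mu> \<in> insert \<nu> F \<or> \<mu> \<notin> spectrum x" for \<mu>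
    using that old new unfolding a_def by blast
  ultimately show ?case using gg gc by blast
qed

text \<open>Splitting off the whole spectrum leaves a corner in which every \<open>x - \<mu>\<close>
  is invertible. Such a corner is zero, so \<open>f = 0\<close> and \<open>P\<close> annihilates
  \<open>x\<close>.\<close>

lemma algebraic_of_poles:
  fixes x :: "'a::complex_banach_algebra"
  assumes "finite (spectrum x)" and "\<And>\<mu>. \<mu> \<in> spectrum x \<Longrightarrow> \<exists>k b. drazin_inverse (x - \<mu> *\<^sub>C 1) k b"
  shows "algebraic_element x"
proof -
  obtain f P where P: "P \<noteq> 0" "poly_eval P x * (1 - f) = 0"
    and "\<And>\<mu>. \<exists>y. corner_inverse f (x - \<mu> *\<^sub>C 1) y"
    using split_off_poles[OF assms] by blast
  then have "f = 0" using corner_spectrum_nonempty by blast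
  then show ?thesis using P by (auto simp: algebraic_element_def)
qed

text \<open>The frontier is compact without limit points, hence finite, and the plane minus a finite
  set is connected. It is covered by the disjoint open sets \<open>interior S\<close> and
  \<open>- S\<close>; the latter is nonempty because \<open>S\<close> is compact, so the interior is
  empty.\<close>

lemma finite_of_isolated_frontier:
  fixes S :: "complex set"
  assumes S: "compact S" and iso: "\<And>\<mu>. \<mu> \<in> frontier S \<Longrightarrow> \<mu> isolated_in S"
  shows "finite S" "frontier S = S"
proof -
  have sub: "frontier S \<subseteq> S" using S compact_imp_closed frontier_subset_closed by blast
  have fin: "finite (frontier S)"
  proof (rule ccontr)
    assume "infinite (frontier S)"
    then obtain \<mu> where \<mu>: "\<mu> \<in> frontier S" "\<mu> islimpt frontier S"
      using compact_frontier[OF S] unfolding compact_eq_Bolzano_Weierstrass by blast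
    then have "\<mu> islimpt S" using sub islimpt_subset by blast
    then show False using iso[OF \<mu>(1)] by (simp add: isolated_in_islimpt_iff)
  qed
  have "connected (- frontier S)"
    using fin by (intro path_connected_imp_connected path_connected_complement_countable)
      (auto intro: countable_finite)
  moreover have "- frontier S \<subseteq> interior S \<union> - S"
    by (auto simp: frontier_def closure_def)
  moreover have "interior S \<inter> - S \<inter> - frontier S = {}"
    using interior_subset by blast
  moreover have "open (- S)" using S compact_imp_closed by auto
  ultimately have "interior S \<inter> - frontier S = {} \<or> - S \<inter> - frontier S = {}"
    using connectedD[of "- frontier S" "interior S" "- S"] by blast
  moreover have "- S \<inter> - frontier S \<noteq> {}"
  proof -
    have "S \<noteq> UNIV" using S not_compact_UNIV by blast
    then show ?thesis using sub by blast
  qed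
  ultimately have "interior S = {}" by (auto simp: frontier_def)
  then show eq: "frontier S = S" using S by (simp add: frontier_def closure_closed compact_imp_closed)
  then show "finite S" using fin by simp
qed

theorem corollary4p4:
  fixes x :: "'a::complex_banach_algebra"
  assumes "semiprime (ring_of_type_algebra :: 'a ring)"
    and "soc (ring_of_type_algebra :: 'a ring) \<noteq> {0}"
  shows "bf_resolvent_set x \<inter> frontier (spectrum x) = resolvent_poles x \<and>
    (bf_spectrum x = {} \<longleftrightarrow> frontier (spectrum x) \<subseteq> bf_resolvent_set x) \<and>
    (frontier (spectrum x) \<subseteq> bf_resolvent_set x \<longleftrightarrow> algebraic_element x)"
proof -
  have rho: "\<mu> \<in> bf_resolvent_set x \<longleftrightarrow> b_fredholm RT (x - \<mu> *\<^sub>C 1)" for \<mu>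
    by (simp add: bf_resolvent_set_def bf_spectrum_def)
  have sub: "frontier (spectrum x) \<subseteq> spectrum x"
    using closed_spectrum frontier_subset_closed by blast
  have poles: "bf_resolvent_set x \<inter> frontier (spectrum x) = resolvent_poles x"
  proof (intro equalityI subsetI)
    fix \<mu> assume \<mu>: "\<mu> \<in> bf_resolvent_set x \<inter> frontier (spectrum x)"
    then have "\<exists>b k. drazin_inverse (x - \<mu> *\<^sub>C 1) k b"
      by (intro b_fredholm_boundary_drazin frontier_spectrum_approx) (auto simp: rho)
    then show "\<mu> \<in> resolvent_poles x" using drazin_pole \<mu> sub by blast
  next
    fix \<mu> assume \<mu>: "\<mu> \<in> resolvent_poles x"
    then have iso: "\<mu> isolated_in spectrum x" by (simp add: resolvent_poles_def)
    \<comment> \<open>Interior points of the spectrum are limit points of it, isolated points are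
      not.\<close>
    have "\<mu> \<notin> interior (spectrum x)"
      using iso islimpt_subset[OF interior_limit_point interior_subset]
      by (metis interior_limit_point interior_subset isolated_in_islimpt_iff subsetD)
    moreover have "\<mu> \<in> spectrum x" using iso by (simp add: isolated_in_islimpt_iff)
    ultimately have "\<mu> \<in> frontier (spectrum x)"
      using closure_subset by (auto simp: frontier_def)
    moreover have "\<mu> \<in> bf_resolvent_set x"
      using pole_drazin[OF \<mu>] drazin_b_fredholm by (auto simp: rho)
    ultimately show "\<mu> \<in> bf_resolvent_set x \<inter> frontier (spectrum x)" by simp
  qed
  \<comment> \<open>The equivalences are proved as a cycle: (ii) to (iii), (iii) to (i), (i) to
    (ii).\<close>
  have "algebraic_element x" if "frontier (spectrum x) \<subseteq> bf_resolvent_set x"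
  proof -
    have fp: "frontier (spectrum x) \<subseteq> resolvent_poles x" using that poles by blast
    then have "\<mu> isolated_in spectrum x" if "\<mu> \<in> frontier (spectrum x)" for \<mu>
      using that by (auto simp: resolvent_poles_def)
    note * = finite_of_isolated_frontier[OF compact_spectrum this]
    show ?thesis by (rule algebraic_of_poles) (use * fp pole_drazin in blast)+
  qed
  moreover have "bf_spectrum x = {}" if "algebraic_element x"
    using algebraic_drazin[OF that] drazin_b_fredholm unfolding bf_spectrum_def by blast
  moreover have "frontier (spectrum x) \<subseteq> bf_resolvent_set x" if "bf_spectrum x = {}"
    using that by (simp add: bf_resolvent_set_def)
  ultimately show ?thesis using poles by blast
qed

end
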